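(* Let $\beta\in(0,2]$, $L>0$ and $f_0\in\mathcal H^\beta(L)$. Let $(X,Y)=((X_i,Y_i))_{1\le i\le n}\sim P_{f_0}^n$ be data from the random design regression model. Let $0\le\alpha\le\beta$ and let $\Pi$ be the overparameterized shallow ReLU network prior of width $N_\alpha$ with scaling $\sigma_n$ specified below and weights having density with $p$-exponential tails with parameters $0<p\le1$ and $q$. Let $\varepsilon_n^\ast=n^{-\frac{\beta}{1+2\beta}}$ and $\varepsilon_n^+=n^{-2/5}$. For any $\rho\in(0,1)$ there exists a large enough constant $M>0$ such that, as $n\to\infty$, $$E_{f_0}\Pi_\rho\Big[\Big\{f:\ \tfrac1nD_\rho(P_f^n,P_{f_0}^n)\ge M\varepsilon_n^2\Big\}\ \Big|\ X,Y\Big]\to0,$$ where $\varepsilon_n$ is given by: (i) (oracle $\sigma_n$) for $\sigma_n=N_\alpha^{-\frac2{2+p}}N_\beta^{\frac p{2+p}-\beta}(\log n)^{-\frac2{q(2+p)}}$, $$\varepsilon_n=\varepsilon_n^\ast\,(N_\alpha N_\beta)^{\frac p{2+p}}(\log n)^{\frac p{q(2+p)}};$$ (ii) (non-oracle $\sigma_n$) for $\sigma_n=\varepsilon_n^+/N_\alpha$, $$\varepsilon_n=\varepsilon_n^\ast\; n^{\,p\left(\frac{1-\beta}{2+4\beta}+\frac15+\frac1{2+4\alpha}\right)} .$$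
   Context: Random design regression: one observes i.i.d. pairs $(X_i,Y_i)\in[0,1]\times\mathbb R$, $Y_i=f(X_i)+\xi_i$, with $X_i$ i.i.d. from a distribution $P_X$ on $[0,1]$ and, independently, $\xi_i$ i.i.d. $\mathcal N(0,1)$. $P_f$ is the law of one pair, $P_f^n$ that of the sample, $E_{f_0}$ the expectation under $P_{f_0}^n$. For a prior $\Pi$ on $f$, the $\rho$-posterior is $\Pi_\rho[B\mid X,Y]=\int_Be^{\rho\ell_n(f)}d\Pi(f)/\int e^{\rho\ell_n(f)}d\Pi(f)$ with $\ell_n(f)=-\frac12\sum_{i=1}^n(Y_i-f(X_i))^2$. Hölder ball: for $\beta\in(0,2]$, with $\underline\beta\in\{0,1\}$ the largest integer strictly smaller than $\beta$, $\mathcal H^\beta(L)$ is the set of $f:[0,1]\to\mathbb R$ with $\max_{0\le i\le\underline\beta}\|D^if\|_\infty+\sup_{x\ne y}|D^{\underline\beta}f(x)-D^{\underline\beta}f(y)|/|x-y|^{\beta-\underline\beta}\le L$. Rényi divergence: $D_\rho(P,Q)=\frac1{\rho-1}\log\int(dP/dQ)^\rho dQ$. For $s\ge0$, $N_s=2^{m_s}$ where $m_s$ is the closest integer solution to $2^{m_s}=n^{1/(2s+1)}$ (so $N_s\asymp n^{1/(2s+1)}$). Shallow ReLU network prior: $f(x)=\sum_{k=0}^{N_\alpha-1}w_k(x-a_k)_++b$, with $(u)_+=\max(u,0)$, $a_k=k/N_\alpha$ deterministic, $w_k=\sigma_n\zeta_k$ with $\zeta_k$ i.i.d. of density $h$,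 $\sigma_n>0$ deterministic, and $b\sim\pi_b$ independent of the weights, where $\pi_b$ has a symmetric, continuous, strictly positive density on $\mathbb R$. $p$-exponential tails with parameters $(p,q)$: $h$ is symmetric about $0$; $h(t)\ge c_0e^{-c_1t^p}$ for $t\ge0$, some $c_0,c_1>0$; and for $q\in(0,p]$ and some $d_0,d_1,M_0>0$, $\int_x^\infty h(t)dt\le d_0e^{-d_1x^q}$ for $x\ge M_0$. *)

theory Defs
  imports "HOL-Probability.Probability"
begin

text \<open>The derivative is taken within the unit interval, so it is one-sided at the endpoints.\<close>

definition iter_deriv :: "nat \<Rightarrow> (real \<Rightarrow> real) \<Rightarrow> real \<Rightarrow> real" where
  "iter_deriv i f = ((\<lambda>g x. vector_derivative g (at x within {0..1})) ^^ i) f"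

definition holder_order :: "real \<Rightarrow> nat" where
  "holder_order \<beta> = nat (\<lceil>\<beta>\<rceil> - 1)"

text \<open>Suprema are taken in the extended nonnegative reals, where a supremum of an unbounded
  family is infinite.\<close>

definition holder_norm :: "real \<Rightarrow> (real \<Rightarrow> real) \<Rightarrow> ennreal" where
  "holder_norm \<beta> f =
     Max ((\<lambda>i. SUP x\<in>{0..1}. ennreal \<bar>iter_deriv i f x\<bar>) ` {0..holder_order \<beta>})
     + (SUP (x, y)\<in>{(x, y). x \<in> {0..1} \<and> y \<in> {0..1} \<and> x \<noteq> y}.
          ennreal (\<bar>iter_deriv (holder_order \<beta>) f x - iter_deriv (holder_order \<beta>) f y\<bar>
                   / \<bar>x - y\<bar> powr (\<beta> - real (holder_order \<beta>))))"

text \<open>Values outside the unit interval are unconstrained (and never used below).\<close>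

definition holder_ball :: "real \<Rightarrow> real \<Rightarrow> (real \<Rightarrow> real) set" where
  "holder_ball \<beta> L =
     {f. (\<forall>i<holder_order \<beta>. iter_deriv i f differentiable_on {0..1}) \<and>
         holder_norm \<beta> f \<le> ennreal L}"

definition std_normal :: "real measure" where
  "std_normal = density lborel (\<lambda>z. ennreal (std_normal_density z))"

definition pair_law :: "real measure \<Rightarrow> (real \<Rightarrow> real) \<Rightarrow> (real \<times> real) measure" where
  "pair_law PX f =
     distr (PX \<Otimes>\<^sub>M std_normal) (PX \<Otimes>\<^sub>M borel) (\<lambda>(x, z). (x, f x + z))"

definition sample_law ::
    "real measure \<Rightarrow> nat \<Rightarrow> (real \<Rightarrow> real) \<Rightarrow> (nat \<Rightarrow> real \<times> real) measure" where
  "sample_law PX n f = PiM {1..n} (\<lambda>_. pair_law PX f)"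

definition renyi_div :: "real \<Rightarrow> 'a measure \<Rightarrow> 'a measure \<Rightarrow> real" where
  "renyi_div \<rho> P Q =
     1 / (\<rho> - 1) * ln (\<integral>x. enn2real (RN_deriv Q P x) powr \<rho> \<partial>Q)"

definition loglik :: "nat \<Rightarrow> (nat \<Rightarrow> real \<times> real) \<Rightarrow> (real \<Rightarrow> real) \<Rightarrow> real" where
  "loglik n D f = - (1 / 2) * (\<Sum>i=1..n. (snd (D i) - f (fst (D i)))\<^sup>2)"

definition rho_posterior ::
    "real \<Rightarrow> (real \<Rightarrow> real) measure \<Rightarrow> nat \<Rightarrow> (nat \<Rightarrow> real \<times> real) \<Rightarrow> (real \<Rightarrow> real) set \<Rightarrow> real" where
  "rho_posterior \<rho> prior n D B =
     (LINT f:B|prior. exp (\<rho> * loglik n D f)) / (LINT f|prior. exp (\<rho> * loglik n D f))"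

text \<open>The space of continuous functions on the unit interval. The trace of the product
  sigma-algebra (generated by the point evaluations) is the Borel sigma-algebra of the
  supremum norm.\<close>

definition cont_space :: "(real \<Rightarrow> real) measure" where
  "cont_space = restrict_space (PiM {0..1} (\<lambda>_. borel)) {f. continuous_on {0..1} f}"

text \<open>Two to the power of the integer nearest to the real solution \<open>m\<close> of
  \<open>2 powr m = n powr (1 / (2 * s + 1))\<close>.\<close>

definition width :: "real \<Rightarrow> nat \<Rightarrow> nat" where
  "width s n = 2 ^ nat (round (log 2 (real n) / (2 * s + 1)))"

definition relu_net :: "nat \<Rightarrow> (nat \<Rightarrow> real) \<Rightarrow> real \<Rightarrow> real \<Rightarrow> real" where
  "relu_net N w b x = (\<Sum>k<N. w k * max (x - real k / real N) 0) + b"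

definition relu_prior ::
    "nat \<Rightarrow> real \<Rightarrow> (real \<Rightarrow> real) \<Rightarrow> (real \<Rightarrow> real) \<Rightarrow> (real \<Rightarrow> real) measure" where
  "relu_prior N \<sigma> h g =
     distr (PiM {..<N} (\<lambda>_. density lborel (\<lambda>t. ennreal (h t)))
              \<Otimes>\<^sub>M density lborel (\<lambda>t. ennreal (g t)))
       cont_space
       (\<lambda>(\<zeta>, b). restrict (relu_net N (\<lambda>k. \<sigma> * \<zeta> k) b) {0..1})"

definition prob_density :: "(real \<Rightarrow> real) \<Rightarrow> bool" where
  "prob_density h \<longleftrightarrow>
     h \<in> borel_measurable borel \<and> (\<forall>t. 0 \<le> h t) \<and> (\<integral>\<^sup>+ t. ennreal (h t) \<partial>lborel) = 1"

definition exp_tails :: "real \<Rightarrow> real \<Rightarrow> (real \<Rightarrow> real) \<Rightarrow> bool" where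
  "exp_tails p q h \<longleftrightarrow>
     (\<forall>t. h (- t) = h t) \<and>
     (\<exists>c0>0. \<exists>c1>0. \<forall>t\<ge>0. c0 * exp (- c1 * t powr p) \<le> h t) \<and>
     0 < q \<and> q \<le> p \<and>
     (\<exists>d0>0. \<exists>d1>0. \<exists>M0>0. \<forall>x\<ge>M0. (LINT t:{x..}|lborel. h t) \<le> d0 * exp (- d1 * x powr q))"

definition expected_posterior_mass ::
    "real \<Rightarrow> real measure \<Rightarrow> (real \<Rightarrow> real) \<Rightarrow> (real \<Rightarrow> real) measure \<Rightarrow> nat \<Rightarrow> real \<Rightarrow> real" where
  "expected_posterior_mass \<rho> PX f0 prior n r =
     (\<integral>D. rho_posterior \<rho> prior n D
            {f \<in> space cont_space.
               1 / real n * renyi_div \<rho> (sample_law PX n f) (sample_law PX n f0) \<ge> r}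
        \<partial>sample_law PX n f0)"

end

theory Submission
  imports Defs "HOL-Real_Asymp.Real_Asymp"
begin

text \<open>If the prior puts mass at least \<open>exp (- C n \<epsilon>\<^sup>2)\<close> on a uniform ball of radius \<open>C \<epsilon>\<close> around
  the truth, the fractional posterior contracts at rate \<open>\<epsilon>\<close> in Renyi divergence without any entropy
  condition: the expectation of the \<open>\<rho>\<close>-th power of the likelihood ratio is itself \<open>exp (- (1 - \<rho>) D)\<close>.

  For the network prior the truth is replaced by its linear interpolant on the grid of mesh
  \<open>1 / N\<^sub>\<beta>\<close>, whose knots are also knots of the network because \<open>N\<^sub>\<beta>\<close> divides \<open>N\<^sub>\<alpha>\<close>. Its slope changes
  are of order \<open>N\<^sub>\<beta> powr (1 - \<beta>)\<close>, so matching them costs \<open>N\<^sub>\<beta> (N\<^sub>\<beta> powr (1 - \<beta>) / \<sigma>) powr p\<close> in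
  log-probability. The remaining weights are at most \<open>\<sigma> (ln n) powr (1 / q)\<close> with high probability and
  perturb the function by at most \<open>N\<^sub>\<alpha> \<sigma> (ln n) powr (1 / q)\<close>. When \<open>\<beta> > 1\<close> the initial slope is only of
  order one; it is affordable because \<open>p \<le> 1\<close>. The rate balances these quantities.\<close>

section \<open>Laws of the regression sample\<close>

text \<open>Everything is bounded in expectation, with no high-probability event for the data: the
  powers \<open>\<rho>\<close> and \<open>- \<rho>\<close> of the likelihood ratio have usable
  moments, and Fubini exchanges data and prior. The prior mass is computed on the parameter space,
  where the small-ball event is a box and product measure factorises.

  Matched weights only need to be right within one unit before scaling. A narrower window would gain
  nothing, since an error of one \<open>\<sigma>\<close> per weight is dominated by what the
  unmatched weights are allowed; the unit window costs a constant factor per knot. The threshold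
  \<open>(2 / d1 * ln n) powr (1 / q)\<close> makes each tail O(1/n^2), so all of the at most 2n
  weights obey it with probability at least 1/2. Hence the large width never enters the exponent.

  Write the rate as \<kappa> times the minimax rate, \<kappa> \<ge> 1. Two conditions remain: the
  unmatched weights perturb by at most the rate, and the p-th power of slope change over \<sigma> is
  at most of order \<kappa>^2. The oracle scaling solves both as equations. For the other scaling
  the first has room to spare, since n^(-2/5) is the fastest minimax rate for \<beta> \<le> 2, and
  the second dictates \<kappa>.\<close>

locale random_design = prob_space PX for PX :: "real measure" +
  assumes sets_PX: "sets PX = sets (restrict_space borel {0..1})"
begin

lemma space_PX: "space PX = {0..1}"
  using sets_eq_imp_space_eq[OF sets_PX] by (simp add: space_restrict_space)

lemma continuous_on_measurable_PX:
  fixes f :: "real \<Rightarrow> real"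
  assumes "continuous_on {0..1} f"
  shows "f \<in> borel_measurable PX"
proof -
  have "f \<in> borel_measurable (restrict_space borel {0..1})"
    using assms by (rule borel_measurable_continuous_on_restrict)
  then show ?thesis
    using measurable_cong_sets[OF sets_PX refl] by blast
qed

lemma prob_space_std_normal: "prob_space std_normal"
  unfolding std_normal_def by (rule prob_space_normal_density) simp

lemma sets_std_normal [simp, measurable_cong]: "sets std_normal = sets borel"
  by (simp add: std_normal_def)

lemma space_std_normal [simp]: "space std_normal = UNIV"
  by (simp add: std_normal_def)

lemma sets_pair_law [simp, measurable_cong]: "sets (pair_law PX f) = sets (PX \<Otimes>\<^sub>M borel)"
  by (simp add: pair_law_def)

lemma space_pair_law: "space (pair_law PX f) = {0..1} \<times> UNIV"
  by (simp add: pair_law_def space_pair_measure space_PX)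

lemma measurable_shift [measurable]:
  fixes f :: "real \<Rightarrow> real"
  assumes [measurable]: "f \<in> borel_measurable PX"
  shows "(\<lambda>(x, z). (x, f x + z)) \<in> PX \<Otimes>\<^sub>M std_normal \<rightarrow>\<^sub>M PX \<Otimes>\<^sub>M borel"
  by measurable

lemma prob_space_pair_law:
  assumes "f \<in> borel_measurable PX"
  shows "prob_space (pair_law PX f)"
proof -
  interpret N: prob_space std_normal by (rule prob_space_std_normal)
  interpret P: pair_prob_space PX std_normal ..
  show ?thesis
    unfolding pair_law_def by (rule P.prob_space_distr) (rule measurable_shift[OF assms])
qed

lemma nn_integral_pair_law:
  assumes f: "f \<in> borel_measurable PX" and F [measurable]: "F \<in> borel_measurable (PX \<Otimes>\<^sub>M borel)"
  shows "(\<integral>\<^sup>+ d. F d \<partial>pair_law PX f)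
    = (\<integral>\<^sup>+ x. \<integral>\<^sup>+ z. ennreal (std_normal_density z) * F (x, f x + z) \<partial>lborel \<partial>PX)"
proof -
  note [measurable] = f
  interpret N: prob_space std_normal by (rule prob_space_std_normal)
  interpret P: pair_prob_space PX std_normal ..
  have "(\<integral>\<^sup>+ d. F d \<partial>pair_law PX f) = (\<integral>\<^sup>+ p. F (fst p, f (fst p) + snd p) \<partial>(PX \<Otimes>\<^sub>M std_normal))"
    unfolding pair_law_def
    by (subst nn_integral_distr) (auto simp: case_prod_beta intro!: measurable_shift[OF f])
  also have "\<dots> = (\<integral>\<^sup>+ x. \<integral>\<^sup>+ z. F (x, f x + z) \<partial>std_normal \<partial>PX)"
    by (subst N.nn_integral_fst[symmetric]) auto
  also have "\<dots> = (\<integral>\<^sup>+ x. \<integral>\<^sup>+ z. ennreal (std_normal_density z) * F (x, f x + z) \<partial>lborel \<partial>PX)"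
    unfolding std_normal_def
    by (intro nn_integral_cong nn_integral_density) auto
  finally show ?thesis .
qed

lemma nn_integral_lborel_shift:
  assumes [measurable]: "F \<in> borel_measurable borel"
  shows "(\<integral>\<^sup>+ z. F (c + z) \<partial>lborel) = (\<integral>\<^sup>+ z. F z \<partial>(lborel :: real measure))"
  using nn_integral_real_affine[of F 1 c] by simp

text \<open>Integrating over the response instead of the noise puts the laws of all regression
  functions against the same base measure, so that they can be compared by densities.\<close>

lemma nn_integral_pair_law_response:
  assumes f: "f \<in> borel_measurable PX" and F [measurable]: "F \<in> borel_measurable (PX \<Otimes>\<^sub>M borel)"
  shows "(\<integral>\<^sup>+ d. F d \<partial>pair_law PX f)
    = (\<integral>\<^sup>+ x. \<integral>\<^sup>+ y. ennreal (std_normal_density (y - f x)) * F (x, y) \<partial>lborel \<partial>PX)"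
proof -
  have "(\<integral>\<^sup>+ z. ennreal (std_normal_density z) * F (x, f x + z) \<partial>lborel)
      = (\<integral>\<^sup>+ y. ennreal (std_normal_density (y - f x)) * F (x, y) \<partial>lborel)" if "x \<in> space PX" for x
  proof -
    have Fx: "(\<lambda>y. F (x, y)) \<in> borel_measurable borel"
      using that by measurable
    have "(\<lambda>y. ennreal (std_normal_density (y - f x)) * F (x, y)) \<in> borel_measurable borel"
      by (intro borel_measurable_times_ennreal Fx) measurable
    from nn_integral_lborel_shift[OF this, of "f x"] show ?thesis
      by (simp only: add_diff_cancel_left')
  qed
  then show ?thesis
    unfolding nn_integral_pair_law[OF assms] by (rule nn_integral_cong)
qed

text \<open>The quotient of the normal densities with means \<open>f x\<close> and
  \<open>f0 x\<close> at \<open>y\<close>; the normalising constants cancel. It is the density of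
  one pair law with respect to the other.\<close>

definition lik_ratio :: "(real \<Rightarrow> real) \<Rightarrow> (real \<Rightarrow> real) \<Rightarrow> real \<times> real \<Rightarrow> real" where
  "lik_ratio f f0 = (\<lambda>(x, y). exp ((y - f0 x)\<^sup>2 / 2 - (y - f x)\<^sup>2 / 2))"

lemma lik_ratio_measurable [measurable]:
  assumes [measurable]: "f \<in> borel_measurable PX" "f0 \<in> borel_measurable PX"
  shows "lik_ratio f f0 \<in> borel_measurable (PX \<Otimes>\<^sub>M borel)"
  unfolding lik_ratio_def by measurable

lemma lik_ratio_pos: "0 < lik_ratio f f0 d"
  by (simp add: lik_ratio_def case_prod_beta)

lemma pair_law_eq_density:
  assumes f: "f \<in> borel_measurable PX" and f0: "f0 \<in> borel_measurable PX"
  shows "pair_law PX f = density (pair_law PX f0) (\<lambda>d. ennreal (lik_ratio f f0 d))"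
proof (rule measure_eqI)
  fix A assume "A \<in> sets (pair_law PX f)"
  then have A [measurable]: "A \<in> sets (PX \<Otimes>\<^sub>M borel)" by simp
  note [measurable] = f f0
  have *: "std_normal_density (y - f x) = std_normal_density (y - f0 x) * lik_ratio f f0 (x, y)" for x y
    by (simp add: std_normal_density_def lik_ratio_def mult_exp_exp)
  have "emeasure (pair_law PX f) A = (\<integral>\<^sup>+ d. indicator A d \<partial>pair_law PX f)"
    by simp
  also have "\<dots> = (\<integral>\<^sup>+ x. \<integral>\<^sup>+ y. ennreal (std_normal_density (y - f x)) * indicator A (x, y) \<partial>lborel \<partial>PX)"
    by (rule nn_integral_pair_law_response[OF f]) measurable
  also have "\<dots> = (\<integral>\<^sup>+ x. \<integral>\<^sup>+ y. ennreal (std_normal_density (y - f0 x)) *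
      (ennreal (lik_ratio f f0 (x, y)) * indicator A (x, y)) \<partial>lborel \<partial>PX)"
    by (simp only: * ennreal_mult' normal_density_nonneg mult.assoc)
  also have "\<dots> = (\<integral>\<^sup>+ d. ennreal (lik_ratio f f0 d) * indicator A d \<partial>pair_law PX f0)"
    by (rule nn_integral_pair_law_response[OF f0, symmetric]) measurable
  also have "\<dots> = emeasure (density (pair_law PX f0) (\<lambda>d. ennreal (lik_ratio f f0 d))) A"
    by (subst emeasure_density) auto
  finally show "emeasure (pair_law PX f) A
      = emeasure (density (pair_law PX f0) (\<lambda>d. ennreal (lik_ratio f f0 d))) A" .
qed simp

section \<open>Laws of the whole sample and their likelihood ratio\<close>

lemma sets_sample_law [measurable_cong]:
  "sets (sample_law PX n f) = sets (PiM {1..n} (\<lambda>_. PX \<Otimes>\<^sub>M borel))"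
  unfolding sample_law_def by (intro sets_PiM_cong) auto

lemma space_sample_law_fst:
  assumes "D \<in> space (sample_law PX n f)" "i \<in> {1..n}"
  shows "fst (D i) \<in> {0..1}"
  using assms by (auto simp: sample_law_def space_PiM space_pair_law PiE_def Pi_def)

lemma product_prob_space_pair_law:
  assumes "f \<in> borel_measurable PX"
  shows "product_prob_space (\<lambda>_. pair_law PX f)"
  using prob_space_pair_law[OF assms]
  by (simp add: product_prob_space_def product_prob_space_axioms_def product_sigma_finite_def
      prob_space_imp_sigma_finite)

lemma prob_space_sample_law:
  assumes "f \<in> borel_measurable PX"
  shows "prob_space (sample_law PX n f)"
  unfolding sample_law_def by (rule prob_space_PiM) (rule prob_space_pair_law[OF assms])

lemma nn_integral_sample_law_prod:
  assumes f: "f \<in> borel_measurable PX" and "F \<in> borel_measurable (PX \<Otimes>\<^sub>M borel)"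
  shows "(\<integral>\<^sup>+ D. (\<Prod>i=1..n. F (D i)) \<partial>sample_law PX n f) = (\<integral>\<^sup>+ d. F d \<partial>pair_law PX f) ^ n"
proof -
  interpret P: product_prob_space "\<lambda>_ :: nat. pair_law PX f"
    by (rule product_prob_space_pair_law[OF f])
  show ?thesis
    unfolding sample_law_def using assms
    by (subst P.product_nn_integral_prod) (auto simp: measurable_cong_sets[OF sets_pair_law refl])
qed

text \<open>A product measure is determined by its values on boxes, and on a box both the density
  and the indicator factorise over the observations.\<close>

lemma sample_law_eq_density:
  assumes f: "f \<in> borel_measurable PX" and f0: "f0 \<in> borel_measurable PX"
  shows "sample_law PX n f
    = density (sample_law PX n f0) (\<lambda>D. ennreal (\<Prod>i=1..n. lik_ratio f f0 (D i)))"
proof -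
  note [measurable] = f f0
  interpret P: product_prob_space "\<lambda>_ :: nat. pair_law PX f"
    by (rule product_prob_space_pair_law[OF f])
  interpret P0: product_prob_space "\<lambda>_ :: nat. pair_law PX f0"
    by (rule product_prob_space_pair_law[OF f0])
  have "density (sample_law PX n f0) (\<lambda>D. ennreal (\<Prod>i=1..n. lik_ratio f f0 (D i)))
      = PiM {1..n} (\<lambda>_. pair_law PX f)"
  proof (rule P.PiM_eqI)
    show "sets (density (sample_law PX n f0) (\<lambda>D. ennreal (\<Prod>i=1..n. lik_ratio f f0 (D i))))
        = sets (PiM {1..n} (\<lambda>_. pair_law PX f))"
      using sets_sample_law[of n f] sets_sample_law[of n f0] by (simp add: sample_law_def)
    fix A assume "\<And>i :: nat. i \<in> {1..n} \<Longrightarrow> A i \<in> sets (pair_law PX f)"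
    then have A [measurable]: "\<And>i. i \<in> {1..n} \<Longrightarrow> A i \<in> sets (PX \<Otimes>\<^sub>M borel)" by simp
    have box: "PiE {1..n} A \<in> sets (sample_law PX n f0)"
      unfolding sets_sample_law using A by (intro sets_PiM_I_finite) auto
    have "emeasure (density (sample_law PX n f0) (\<lambda>D. ennreal (\<Prod>i=1..n. lik_ratio f f0 (D i)))) (PiE {1..n} A)
        = (\<integral>\<^sup>+ D. ennreal (\<Prod>i=1..n. lik_ratio f f0 (D i)) * indicator (PiE {1..n} A) D \<partial>sample_law PX n f0)"
      using box by (subst emeasure_density) auto
    also have "\<dots> = (\<integral>\<^sup>+ D. (\<Prod>i=1..n. ennreal (lik_ratio f f0 (D i)) * indicator (A i) (D i)) \<partial>sample_law PX n f0)"
    proof (rule nn_integral_cong)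
      fix D assume "D \<in> space (sample_law PX n f0)"
      \<comment> \<open>A box \<open>PiE\<close> also demands the default value outside the index
        set, so its indicator is a product of coordinate indicators only for extensional
        \<open>D\<close>.\<close>
      then have "D \<in> extensional {1..n}" by (simp add: sample_law_def space_PiM PiE_def)
      then have "indicator (PiE {1..n} A) D = (\<Prod>i=1..n. indicator (A i) (D i) :: ennreal)"
        by (auto simp: indicator_def PiE_def Pi_def)
      then show "ennreal (\<Prod>i=1..n. lik_ratio f f0 (D i)) * indicator (PiE {1..n} A) D
          = (\<Prod>i=1..n. ennreal (lik_ratio f f0 (D i)) * indicator (A i) (D i))"
        by (simp add: prod.distrib prod_ennreal less_imp_le[OF lik_ratio_pos])
    qed
    also have "\<dots> = (\<Prod>i=1..n. \<integral>\<^sup>+ d. ennreal (lik_ratio f f0 d) * indicator (A i) d \<partial>pair_law PX f0)"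
      unfolding sample_law_def by (subst P0.product_nn_integral_prod) auto
    also have "\<dots> = (\<Prod>i=1..n. emeasure (pair_law PX f) (A i))"
      unfolding pair_law_eq_density[OF f f0]
      by (intro prod.cong refl emeasure_density[symmetric]) auto
    finally show "emeasure (density (sample_law PX n f0) (\<lambda>D. ennreal (\<Prod>i=1..n. lik_ratio f f0 (D i)))) (PiE {1..n} A)
        = (\<Prod>i=1..n. emeasure (pair_law PX f) (A i))" .
  qed simp
  then show ?thesis by (simp add: sample_law_def)
qed

text \<open>Used with \<open>c\<close> equal to \<open>\<rho>\<close> for the numerator of the
  posterior and to \<open>- \<rho>\<close> for the inverse of its denominator.\<close>

lemma exp_loglik_diff:
  "exp (c * (loglik n D f - loglik n D f0)) = (\<Prod>i=1..n. lik_ratio f f0 (D i) powr c)"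
proof -
  have "c * (loglik n D f - loglik n D f0)
      = (\<Sum>i=1..n. c * ((snd (D i) - f0 (fst (D i)))\<^sup>2 / 2 - (snd (D i) - f (fst (D i)))\<^sup>2 / 2))"
    unfolding loglik_def
    by (simp add: sum_distrib_left sum_subtractf sum_negf algebra_simps flip: sum_divide_distrib)
  then show ?thesis
    by (simp add: exp_sum lik_ratio_def case_prod_beta powr_def)
qed

text \<open>The Radon-Nikodym derivative inside \<open>renyi_div\<close> agrees almost everywhere
  with the explicit product of ratios, and \<open>- (1 - \<rho>)\<close> cancels the prefactor
  \<open>1 / (\<rho> - 1)\<close>, so the exponential undoes the logarithm.\<close>

lemma nn_integral_exp_loglik_le_renyi:
  assumes f: "f \<in> borel_measurable PX" and f0: "f0 \<in> borel_measurable PX" and \<rho>: "0 < \<rho>" "\<rho> < 1"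
  shows "(\<integral>\<^sup>+ D. ennreal (exp (\<rho> * (loglik n D f - loglik n D f0))) \<partial>sample_law PX n f0)
    \<le> ennreal (exp (- (1 - \<rho>) * renyi_div \<rho> (sample_law PX n f) (sample_law PX n f0)))"
proof -
  note [measurable] = f f0
  define Q where "Q = sample_law PX n f0"
  interpret Q: prob_space Q unfolding Q_def by (rule prob_space_sample_law[OF f0])
  define R where "R = (\<lambda>D. \<Prod>i=1..n. lik_ratio f f0 (D i))"
  have [measurable_cong]: "sets Q = sets (PiM {1..n} (\<lambda>_. PX \<Otimes>\<^sub>M borel))"
    by (simp add: Q_def sets_sample_law)
  have R [measurable]: "R \<in> borel_measurable Q"
    unfolding R_def by measurable
  have R_pos: "0 < R D" for D
    unfolding R_def by (intro prod_pos) (simp add: lik_ratio_pos)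
  have R_powr: "exp (\<rho> * (loglik n D f - loglik n D f0)) = R D powr \<rho>" for D
    unfolding exp_loglik_diff R_def by (simp add: prod_powr_distrib less_imp_le[OF lik_ratio_pos])
  have P: "sample_law PX n f = density Q (\<lambda>D. ennreal (R D))"
    unfolding Q_def R_def by (rule sample_law_eq_density[OF f f0])
  have R1: "(\<integral>\<^sup>+ D. ennreal (R D) \<partial>Q) = 1"
    using prob_space.emeasure_space_1[OF prob_space_sample_law[OF f, of n]] unfolding P
    by (subst (asm) emeasure_density) (auto cong: nn_integral_cong)
  have "AE D in Q. ennreal (R D) = RN_deriv Q (sample_law PX n f) D"
    by (rule Q.RN_deriv_unique) (auto simp: P)
  then have "(\<integral>D. enn2real (RN_deriv Q (sample_law PX n f) D) powr \<rho> \<partial>Q) = (\<integral>D. R D powr \<rho> \<partial>Q)"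
    by (intro integral_cong_AE) (auto elim!: eventually_mono simp: less_imp_le[OF R_pos] dest: sym)
  then have renyi: "renyi_div \<rho> (sample_law PX n f) Q = 1 / (\<rho> - 1) * ln (\<integral>D. R D powr \<rho> \<partial>Q)"
    by (simp add: renyi_div_def)
  \<comment> \<open>\<open>renyi_div\<close> uses the Bochner integral, which is zero for
    nonintegrable functions. Domination by \<open>1 + R\<close>, of total mass 2, gives the
    integrability that links it to the nonnegative integral.\<close>
  have "(\<integral>\<^sup>+ D. ennreal (R D powr \<rho>) \<partial>Q) \<le> (\<integral>\<^sup>+ D. 1 + ennreal (R D) \<partial>Q)"
  proof (rule nn_integral_mono)
    fix D
    have "R D powr \<rho> \<le> 1 + R D"
    proof (cases "R D \<le> 1")
      case True
      then have "R D powr \<rho> \<le> 1" using R_pos[of D] \<rho> by (simp add: powr_le1)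
      then show ?thesis using R_pos[of D] by simp
    next
      case False
      then have "R D powr \<rho> \<le> R D powr 1" using \<rho> by (intro powr_mono) auto
      then show ?thesis using R_pos[of D] by simp
    qed
    then show "ennreal (R D powr \<rho>) \<le> 1 + ennreal (R D)"
      using R_pos[of D] by (simp flip: ennreal_1 ennreal_plus)
  qed
  also have "\<dots> = 2"
    by (subst nn_integral_add) (auto simp: R1 Q.emeasure_space_1)
  finally have fin: "(\<integral>\<^sup>+ D. ennreal (R D powr \<rho>) \<partial>Q) < \<infinity>"
    by (auto simp: less_top[symmetric] top_unique)
  then have int: "integrable Q (\<lambda>D. R D powr \<rho>)"
    by (intro integrableI_nonneg) auto
  define I where "I = (\<integral>D. R D powr \<rho> \<partial>Q)"
  have I: "(\<integral>\<^sup>+ D. ennreal (R D powr \<rho>) \<partial>Q) = ennreal I"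
    unfolding I_def by (rule nn_integral_eq_integral[OF int]) auto
  have "I \<ge> 0" unfolding I_def by (simp add: integral_nonneg_AE)
  have "I \<le> exp (- (1 - \<rho>) * renyi_div \<rho> (sample_law PX n f) Q)"
  \<comment> \<open>For \<open>I = 0\<close> the logarithm carries no information, but the claimed
    inequality is then trivial; this is why no equality is stated.\<close>
  proof (cases "I = 0")
    case False
    then have "exp (- (1 - \<rho>) * renyi_div \<rho> (sample_law PX n f) Q) = exp (ln I)"
      using \<rho> unfolding renyi I_def[symmetric] by (simp add: field_simps)
    then show ?thesis using False \<open>I \<ge> 0\<close> by simp
  qed simp
  then show ?thesis
    unfolding R_powr Q_def[symmetric] I by (rule ennreal_leI)
qed

text \<open>Given the design point this is a Gaussian exponential moment. Independence turns the
  bound for one pair into its n-th power.\<close>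

lemma nn_integral_exp_neg_loglik_le:
  assumes f: "f \<in> borel_measurable PX" and f0: "f0 \<in> borel_measurable PX" and \<rho>: "0 < \<rho>" "\<rho> < 1"
    and close: "\<And>x. x \<in> {0..1} \<Longrightarrow> \<bar>f x - f0 x\<bar> \<le> \<eta>"
  shows "(\<integral>\<^sup>+ D. ennreal (exp (- \<rho> * (loglik n D f - loglik n D f0))) \<partial>sample_law PX n f0)
    \<le> ennreal (exp (real n * \<rho> * \<eta>\<^sup>2))"
proof -
  note [measurable] = f f0
  have inner: "(\<integral>\<^sup>+ z. ennreal (std_normal_density z) * ennreal (lik_ratio f f0 (x, f0 x + z) powr - \<rho>) \<partial>lborel)
      \<le> ennreal (exp (\<rho> * \<eta>\<^sup>2))" if x: "x \<in> {0..1}" for x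
  proof -
    define d where "d = f0 x - f x"
    \<comment> \<open>Completing the square: the tilt by \<open>\<rho> * d * z\<close> shifts the
      normal density by \<open>\<rho> * d\<close> and contributes
      \<open>\<rho>\<^sup>2 * d\<^sup>2 / 2\<close> to the exponent. Since
      \<open>\<rho>\<^sup>2 \<le> \<rho>\<close>, the total is at most
      \<open>\<rho> * d\<^sup>2\<close>.\<close>
    have *: "std_normal_density z * lik_ratio f f0 (x, f0 x + z) powr - \<rho>
        = exp ((\<rho> + \<rho>\<^sup>2) * d\<^sup>2 / 2) * std_normal_density (- \<rho> * d + z)" for z
      unfolding std_normal_density_def lik_ratio_def d_def powr_def
      by (simp add: mult_exp_exp) (simp add: power2_eq_square field_simps)
    have "(\<integral>\<^sup>+ z. ennreal (std_normal_density z) * ennreal (lik_ratio f f0 (x, f0 x + z) powr - \<rho>) \<partial>lborel)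
        = (\<integral>\<^sup>+ z. ennreal (exp ((\<rho> + \<rho>\<^sup>2) * d\<^sup>2 / 2)) * ennreal (std_normal_density (- \<rho> * d + z)) \<partial>lborel)"
      by (simp only: * ennreal_mult'[symmetric] normal_density_nonneg exp_ge_zero)
    also have "\<dots> = ennreal (exp ((\<rho> + \<rho>\<^sup>2) * d\<^sup>2 / 2)) *
        (\<integral>\<^sup>+ z. ennreal (std_normal_density (- \<rho> * d + z)) \<partial>lborel)"
      by (rule nn_integral_cmult) auto
    also have "(\<integral>\<^sup>+ z. ennreal (std_normal_density (- \<rho> * d + z)) \<partial>lborel) = 1"
    proof -
      have "(\<integral>\<^sup>+ z. ennreal (std_normal_density z) \<partial>lborel) = 1"
        using prob_space.emeasure_space_1[OF prob_space_std_normal] unfolding std_normal_def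
        by (subst (asm) emeasure_density) auto
      then show ?thesis
        using nn_integral_lborel_shift[of "\<lambda>z. ennreal (std_normal_density z)" "- \<rho> * d"] by simp
    qed
    also have "ennreal (exp ((\<rho> + \<rho>\<^sup>2) * d\<^sup>2 / 2)) * 1 \<le> ennreal (exp (\<rho> * \<eta>\<^sup>2))"
    proof -
      have "d\<^sup>2 \<le> \<eta>\<^sup>2"
        using close[OF x] unfolding d_def by (metis abs_le_square_iff abs_minus_commute abs_of_nonneg abs_ge_zero order_trans)
      moreover have "\<rho>\<^sup>2 \<le> \<rho>" using \<rho> by (simp add: power2_eq_square mult_left_le)
      ultimately have "(\<rho> + \<rho>\<^sup>2) * d\<^sup>2 \<le> (2 * \<rho>) * \<eta>\<^sup>2"
        using \<rho> by (intro mult_mono) auto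
      then show ?thesis by simp
    qed
    finally show ?thesis .
  qed
  have "(\<integral>\<^sup>+ D. ennreal (exp (- \<rho> * (loglik n D f - loglik n D f0))) \<partial>sample_law PX n f0)
      = (\<integral>\<^sup>+ D. (\<Prod>i=1..n. ennreal (lik_ratio f f0 (D i) powr - \<rho>)) \<partial>sample_law PX n f0)"
    unfolding exp_loglik_diff by (simp add: prod_ennreal)
  also have "\<dots> = (\<integral>\<^sup>+ d. ennreal (lik_ratio f f0 d powr - \<rho>) \<partial>pair_law PX f0) ^ n"
    by (rule nn_integral_sample_law_prod[OF f0]) measurable
  also have "\<dots> \<le> ennreal (exp (\<rho> * \<eta>\<^sup>2)) ^ n"
  proof (rule power_mono)
    have "(\<integral>\<^sup>+ d. ennreal (lik_ratio f f0 d powr - \<rho>) \<partial>pair_law PX f0)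
        = (\<integral>\<^sup>+ x. \<integral>\<^sup>+ z. ennreal (std_normal_density z) * ennreal (lik_ratio f f0 (x, f0 x + z) powr - \<rho>) \<partial>lborel \<partial>PX)"
      by (rule nn_integral_pair_law[OF f0]) measurable
    also have "\<dots> \<le> (\<integral>\<^sup>+ x. ennreal (exp (\<rho> * \<eta>\<^sup>2)) \<partial>PX)"
      by (rule nn_integral_mono) (auto simp: space_PX intro!: inner)
    finally show "(\<integral>\<^sup>+ d. ennreal (lik_ratio f f0 d powr - \<rho>) \<partial>pair_law PX f0) \<le> ennreal (exp (\<rho> * \<eta>\<^sup>2))"
      by (simp add: emeasure_space_1)
  qed simp
  also have "\<dots> = ennreal (exp (real n * \<rho> * \<eta>\<^sup>2))"
    by (simp add: ennreal_power exp_of_nat_mult[symmetric] mult.assoc)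
  finally show ?thesis .
qed

end

section \<open>Posterior contraction from small-ball mass\<close>

text \<open>A number in the unit interval is at most its square root, and \<open>N / Z\<close> is
  the product of \<open>t * N\<close> and \<open>1 / (t * Z)\<close>. The free parameter
  \<open>t\<close> later balances the two terms of the mean.\<close>

lemma le_average_scaled:
  fixes N Z t :: real
  assumes "0 \<le> N" "N \<le> Z" "0 < Z" "0 < t"
  shows "N / Z \<le> (t * N + 1 / (t * Z)) / 2"
proof -
  define a where "a = N / Z"
  have a: "0 \<le> a" "a \<le> 1" using assms by (auto simp: a_def)
  have "(2 * a)\<^sup>2 \<le> 4 * a"
    using a by (simp add: power2_eq_square mult_left_le)
  also have "4 * a = 4 * (t * N) * (1 / (t * Z))"
    using assms by (simp add: a_def)
  also have "4 * x * y \<le> (x + y)\<^sup>2" for x y :: real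
    using sum_squares_bound[of x y] by (simp add: power2_sum)
  finally have "2 * a \<le> t * N + 1 / (t * Z)"
    by (rule power2_le_imp_le) (use assms in auto)
  then show ?thesis by (simp add: a_def field_simps)
qed

text \<open>The indicator of \<open>A\<close> is the product of \<open>exp (v / 2)\<close> and
  \<open>exp (- v / 2)\<close> restricted to \<open>A\<close>; apply Cauchy-Schwarz and divide. The
  bound is linear in \<open>exp (- v)\<close>, so data expectations can be taken inside it.\<close>

lemma (in prob_space) inverse_integral_exp_le:
  fixes v :: "'a \<Rightarrow> real"
  assumes [measurable]: "v \<in> borel_measurable M" and A [measurable]: "A \<in> sets M"
    and int: "integrable M (\<lambda>\<omega>. exp (v \<omega>))" and pos: "0 < prob A" "0 < (\<integral>\<omega>. exp (v \<omega>) \<partial>M)"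
  shows "ennreal (1 / (\<integral>\<omega>. exp (v \<omega>) \<partial>M))
    \<le> ennreal (1 / (prob A)\<^sup>2) * (\<integral>\<^sup>+ \<omega>. indicator A \<omega> * ennreal (exp (- v \<omega>)) \<partial>M)"
proof -
  define Z where "Z = (\<integral>\<omega>. exp (v \<omega>) \<partial>M)"
  define V where "V = (\<integral>\<^sup>+ \<omega>. indicator A \<omega> * ennreal (exp (- v \<omega>)) \<partial>M)"
  define F where "F = (\<lambda>\<omega>. indicator A \<omega> * ennreal (exp (v \<omega> / 2)))"
  define G where "G = (\<lambda>\<omega>. indicator A \<omega> * ennreal (exp (- v \<omega> / 2)))"
  have [measurable]: "F \<in> borel_measurable M" "G \<in> borel_measurable M"
    unfolding F_def G_def by measurable
  have FG: "F \<omega> * G \<omega> = indicator A \<omega>" for \<omega>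
    by (simp add: F_def G_def indicator_def mult_exp_exp flip: ennreal_mult')
  have FF: "F \<omega> ^ 2 \<le> ennreal (exp (v \<omega>))" for \<omega>
    by (simp add: F_def indicator_def ennreal_power flip: exp_of_nat_mult)
  have GG: "G \<omega> ^ 2 = indicator A \<omega> * ennreal (exp (- v \<omega>))" for \<omega>
    by (simp add: G_def indicator_def ennreal_power flip: exp_of_nat_mult)
  have "ennreal ((prob A)\<^sup>2) = (\<integral>\<^sup>+ \<omega>. F \<omega> * G \<omega> \<partial>M)\<^sup>2"
    unfolding FG by (simp add: emeasure_eq_measure ennreal_power)
  also have "\<dots> \<le> (\<integral>\<^sup>+ \<omega>. F \<omega> ^ 2 \<partial>M) * (\<integral>\<^sup>+ \<omega>. G \<omega> ^ 2 \<partial>M)"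
    by (rule Cauchy_Schwarz_nn_integral) auto
  also have "\<dots> \<le> (\<integral>\<^sup>+ \<omega>. ennreal (exp (v \<omega>)) \<partial>M) * V"
    unfolding GG V_def by (intro mult_right_mono nn_integral_mono FF) simp
  also have "(\<integral>\<^sup>+ \<omega>. ennreal (exp (v \<omega>)) \<partial>M) = ennreal Z"
    unfolding Z_def by (rule nn_integral_eq_integral[OF int]) simp
  finally have *: "ennreal ((prob A)\<^sup>2) \<le> ennreal Z * V" .
  have Z: "0 < Z" using pos by (simp add: Z_def)
  show ?thesis
  proof (cases V)
    case (real w)
    with * Z have "(prob A)\<^sup>2 \<le> Z * w"
      by (simp flip: ennreal_mult')
    then have "1 / Z \<le> 1 / (prob A)\<^sup>2 * w"
      using Z pos by (simp add: field_simps)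
    then show ?thesis
      using real unfolding Z_def[symmetric] V_def[symmetric]
      by (simp flip: ennreal_mult')
  next
    case top
    then show ?thesis using pos unfolding V_def[symmetric] by (simp add: ennreal_mult_top)
  qed
qed

lemma loglik_nonpos: "loglik n D f \<le> 0"
  by (simp add: loglik_def sum_nonneg)

lemma measurable_cont_space_eval:
  assumes "x \<in> {0..1}"
  shows "(\<lambda>f. f x) \<in> borel_measurable cont_space"
  unfolding cont_space_def
  by (rule measurable_restrict_space1) (rule measurable_component_singleton[OF assms])

lemma space_cont_space: "space cont_space = {f \<in> extensional {0..1}. continuous_on {0..1} f}"
  by (auto simp: cont_space_def space_restrict_space space_PiM PiE_def)

context random_design
begin

lemma loglik_cong:
  assumes "D \<in> space (sample_law PX n f0)" "\<And>x. x \<in> {0..1} \<Longrightarrow> f x = f' x"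
  shows "loglik n D f = loglik n D f'"
  using assms space_sample_law_fst[OF assms(1)] by (simp add: loglik_def)

lemma measurable_loglik_cont_space:
  assumes "D \<in> space (sample_law PX n f0)"
  shows "(\<lambda>f. loglik n D f) \<in> borel_measurable cont_space"
proof -
  have "(\<lambda>f. f (fst (D i))) \<in> borel_measurable cont_space" if "i \<in> {1..n}" for i
    using space_sample_law_fst[OF assms that] by (rule measurable_cont_space_eval)
  then show ?thesis
    unfolding loglik_def
    by (intro borel_measurable_times borel_measurable_sum borel_measurable_power
        borel_measurable_diff borel_measurable_const) auto
qed

text \<open>The integral of a nonintegrable function is zero, so the measurability of the event need not be
  established.\<close>

lemma rho_posterior_nonmeasurable:
  assumes B: "B \<subseteq> space cont_space" "B \<notin> sets cont_space" and prior: "sets prior = sets cont_space"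
  shows "rho_posterior \<rho> prior n D B = 0"
proof -
  have "\<not> integrable prior (\<lambda>f. indicator B f *\<^sub>R exp (\<rho> * loglik n D f))"
  proof
    assume "integrable prior (\<lambda>f. indicator B f *\<^sub>R exp (\<rho> * loglik n D f))"
    then have "(\<lambda>f. indicator B f *\<^sub>R exp (\<rho> * loglik n D f)) \<in> borel_measurable cont_space"
      using borel_measurable_integrable measurable_cong_sets[OF prior refl] by blast
    \<comment> \<open>The exponential never vanishes, so \<open>B\<close> is recovered as the
      positivity set of the integrand.\<close>
    then have "{f \<in> space cont_space. indicator B f *\<^sub>R exp (\<rho> * loglik n D f) > 0} \<in> sets cont_space"
      by (rule borel_measurable_less[OF borel_measurable_const])
    also have "{f \<in> space cont_space. indicator B f *\<^sub>R exp (\<rho> * loglik n D f) > 0} = B"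
    proof -
      have "indicator B f *\<^sub>R exp (\<rho> * loglik n D f) > 0 \<longleftrightarrow> f \<in> B" for f
        by (cases "f \<in> B") auto
      then show ?thesis using B(1) by (simp only:) blast
    qed
    finally show False using B(2) by simp
  qed
  then show ?thesis
    by (simp add: rho_posterior_def set_lebesgue_integral_def not_integrable_integral_eq)
qed

text \<open>The ratio of the two integrals defining the posterior is at most one, hence bounded by its
  square root and so by an arithmetic mean; this separates numerator from denominator. The inverse of
  the denominator is then controlled by the Cauchy-Schwarz inequality on the event \<open>A\<close>, on which
  the regression functions are close to the truth.\<close>

lemma expected_posterior_mass_le:
  fixes \<Omega> :: "'w measure" and G :: "'w \<Rightarrow> real \<Rightarrow> real"
  assumes \<Omega>: "prob_space \<Omega>"
    and G: "(\<lambda>p. G (fst p) (snd p)) \<in> borel_measurable (\<Omega> \<Otimes>\<^sub>M PX)"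
    and T: "(\<lambda>\<omega>. restrict (G \<omega>) {0..1}) \<in> \<Omega> \<rightarrow>\<^sub>M cont_space"
    and f0: "f0 \<in> borel_measurable PX"
    and \<rho>: "0 < \<rho>" "\<rho> < 1"
    and A: "A \<in> sets \<Omega>"
    and close: "\<And>\<omega> x. \<omega> \<in> A \<Longrightarrow> x \<in> {0..1} \<Longrightarrow> \<bar>G \<omega> x - f0 x\<bar> \<le> \<eta>"
    and mass: "exp (- c) \<le> measure \<Omega> A" and n: "0 < n"
  shows "expected_posterior_mass \<rho> PX f0 (distr \<Omega> cont_space (\<lambda>\<omega>. restrict (G \<omega>) {0..1})) n r
    \<le> exp ((c + real n * \<rho> * \<eta>\<^sup>2 - (1 - \<rho>) * real n * r) / 2)"
proof -
  interpret \<Omega>: prob_space \<Omega> by (rule \<Omega>)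
  define Q where "Q = sample_law PX n f0"
  interpret Q: prob_space Q unfolding Q_def by (rule prob_space_sample_law[OF f0])
  interpret P: pair_prob_space \<Omega> Q ..
  have Q_sets [measurable_cong]: "sets Q = sets (PiM {1..n} (\<lambda>_. PX \<Otimes>\<^sub>M borel))"
    by (simp add: Q_def sets_sample_law)
  note [measurable] = f0 A
  define T where "T = (\<lambda>\<omega>. restrict (G \<omega>) {0..1})"
  have T_meas [measurable]: "T \<in> \<Omega> \<rightarrow>\<^sub>M cont_space" using assms(3) by (simp add: T_def)
  define prior where "prior = distr \<Omega> cont_space T"
  define B where "B = {f \<in> space cont_space. 1 / real n * renyi_div \<rho> (sample_law PX n f) Q \<ge> r}"
  have B_sub: "B \<subseteq> space cont_space" unfolding B_def by (rule Collect_subset)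
  define m where "m = exp ((c + real n * \<rho> * \<eta>\<^sup>2 - (1 - \<rho>) * real n * r) / 2)"
  have goal_eq: "expected_posterior_mass \<rho> PX f0 (distr \<Omega> cont_space (\<lambda>\<omega>. restrict (G \<omega>) {0..1})) n r
      = (\<integral>D. rho_posterior \<rho> prior n D B \<partial>Q)"
    by (simp add: expected_posterior_mass_def prior_def T_def B_def Q_def)
  have "(\<integral>D. rho_posterior \<rho> prior n D B \<partial>Q) \<le> m"
  proof (cases "B \<in> sets cont_space")
    case False
    then have "rho_posterior \<rho> prior n D B = 0" for D
      by (intro rho_posterior_nonmeasurable) (simp_all add: B_sub prior_def)
    then show ?thesis by (simp add: m_def)
  next
    case True
    note [measurable] = True
    define v where "v = (\<lambda>\<omega> D. \<rho> * (loglik n D (G \<omega>) - loglik n D f0))"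
    define B' where "B' = T -` B \<inter> space \<Omega>"
    have B'[measurable]: "B' \<in> sets \<Omega>" unfolding B'_def by measurable
    have G_comp: "(\<lambda>p. G (fst p) (fst (snd p i))) \<in> borel_measurable (\<Omega> \<Otimes>\<^sub>M Q)" if "i \<in> {1..n}" for i
    proof -
      have "(\<lambda>p. (fst p, fst (snd p i))) \<in> \<Omega> \<Otimes>\<^sub>M Q \<rightarrow>\<^sub>M \<Omega> \<Otimes>\<^sub>M PX"
        using that by measurable
      from measurable_compose[OF this G] show ?thesis by simp
    qed
    have Y_comp: "(\<lambda>p. snd (snd p i)) \<in> borel_measurable (\<Omega> \<Otimes>\<^sub>M Q)" if "i \<in> {1..n}" for i
      using that by measurable
    have v_meas [measurable]: "(\<lambda>p. v (fst p) (snd p)) \<in> borel_measurable (\<Omega> \<Otimes>\<^sub>M Q)"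
    proof -
      have "(\<lambda>p. loglik n (snd p) (G (fst p))) \<in> borel_measurable (\<Omega> \<Otimes>\<^sub>M Q)"
        unfolding loglik_def
        by (intro borel_measurable_times borel_measurable_sum borel_measurable_power
            borel_measurable_diff borel_measurable_const G_comp Y_comp)
      moreover have "(\<lambda>p. loglik n (snd p) f0) \<in> borel_measurable (\<Omega> \<Otimes>\<^sub>M Q)"
        unfolding loglik_def by measurable
      ultimately show ?thesis unfolding v_def by measurable
    qed
    have v_T: "v \<omega> D = \<rho> * (loglik n D (T \<omega>) - loglik n D f0)" if "D \<in> space Q" for \<omega> D
      using loglik_cong[of D n f0 "G \<omega>" "T \<omega>"] that by (simp add: v_def T_def Q_def)
    define P where "P = \<Omega>.prob A"
    have P: "0 < P" using mass exp_gt_zero[of "- c"] unfolding P_def by linarith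
    \<comment> \<open>With this \<open>t\<close> the numerator bound
      \<open>t / 2 * exp (- (1 - \<rho>) * n * r)\<close> equals \<open>m / 2\<close>, and so does
      the denominator bound \<open>exp (c + n * \<rho> * \<eta>\<^sup>2) / (2 * t)\<close>.\<close>
    define t where "t = exp ((c + real n * \<rho> * \<eta>\<^sup>2 + (1 - \<rho>) * real n * r) / 2)"
    have t: "0 < t" by (simp add: t_def)
    have pointwise: "ennreal (rho_posterior \<rho> prior n D B)
        \<le> ennreal (t / 2) * (\<integral>\<^sup>+ \<omega>. indicator B' \<omega> * ennreal (exp (v \<omega> D)) \<partial>\<Omega>)
        + ennreal (1 / (2 * t * P\<^sup>2)) * (\<integral>\<^sup>+ \<omega>. indicator A \<omega> * ennreal (exp (- v \<omega> D)) \<partial>\<Omega>)"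
      if D: "D \<in> space Q" for D
    proof -
      have [measurable]: "(\<lambda>\<omega>. v \<omega> D) \<in> borel_measurable \<Omega>"
        using measurable_compose[OF measurable_Pair2'[OF D] v_meas] by simp
      have ll [measurable]: "loglik n D \<in> borel_measurable cont_space"
        using measurable_loglik_cont_space[of D n f0] D by (simp add: Q_def)
      define Z where "Z = (\<integral>\<omega>. exp (v \<omega> D) \<partial>\<Omega>)"
      define N where "N = (\<integral>\<omega>. indicator B' \<omega> * exp (v \<omega> D) \<partial>\<Omega>)"
      \<comment> \<open>Numerator and denominator share this factor, which does not depend on
        \<open>\<omega>\<close>; removing it replaces the likelihood by the likelihood ratio
        \<open>exp (v \<omega> D)\<close>.\<close>
      define e where "e = exp (\<rho> * loglik n D f0)"
      have e: "0 < e" by (simp add: e_def)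
      have uT: "exp (\<rho> * loglik n D (T \<omega>)) = e * exp (v \<omega> D)" for \<omega>
        by (simp add: v_T[OF D] e_def mult_exp_exp right_diff_distrib)
      \<comment> \<open>As log-likelihoods are nonpositive, for fixed data the ratio is bounded
        uniformly in the parameter, which gives integrability.\<close>
      have bd: "exp (v \<omega> D) \<le> 1 / e" for \<omega>
        using loglik_nonpos[of n D "G \<omega>"] \<rho>
        by (simp add: v_def e_def exp_minus_inverse right_diff_distrib exp_diff divide_right_mono mult_nonneg_nonpos)
      have int: "integrable \<Omega> (\<lambda>\<omega>. exp (v \<omega> D))"
        by (rule \<Omega>.integrable_const_bound[where B = "1 / e"]) (auto simp: bd)
      have intB: "integrable \<Omega> (\<lambda>\<omega>. indicator B' \<omega> * exp (v \<omega> D))"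
        by (rule integrable_real_mult_indicator[OF B' int, unfolded mult.commute[of _ "indicator _ _"]])
      have num: "(LINT f:B|prior. exp (\<rho> * loglik n D f)) = e * N"
      proof -
        have "(LINT f:B|prior. exp (\<rho> * loglik n D f))
            = (\<integral>\<omega>. indicator B (T \<omega>) *\<^sub>R exp (\<rho> * loglik n D (T \<omega>)) \<partial>\<Omega>)"
          unfolding set_lebesgue_integral_def prior_def by (subst integral_distr) auto
        also have "\<dots> = (\<integral>\<omega>. e * (indicator B' \<omega> * exp (v \<omega> D)) \<partial>\<Omega>)"
          by (intro Bochner_Integration.integral_cong refl) (auto simp: uT B'_def indicator_def)
        finally show ?thesis by (simp add: N_def)
      qed
      have den: "(LINT f|prior. exp (\<rho> * loglik n D f)) = e * Z"
      proof -
        have "(LINT f|prior. exp (\<rho> * loglik n D f)) = (\<integral>\<omega>. exp (\<rho> * loglik n D (T \<omega>)) \<partial>\<Omega>)"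
          unfolding prior_def by (subst integral_distr) auto
        also have "\<dots> = e * Z" by (simp add: uT Z_def)
        finally show ?thesis .
      qed
      have post: "rho_posterior \<rho> prior n D B = N / Z"
        using e by (simp add: rho_posterior_def num den)
      have N0: "0 \<le> N" unfolding N_def by (intro integral_nonneg_AE) auto
      have NZ: "N \<le> Z" unfolding N_def Z_def
        by (intro integral_mono intB int) (auto simp: indicator_def)
      have Z: "0 < Z"
      proof -
        have "Z \<noteq> 0"
          unfolding Z_def using \<Omega>.not_empty
          by (subst integral_nonneg_eq_0_iff_AE[OF int]) (auto simp: \<Omega>.AE_False)
        then show ?thesis using N0 NZ by simp
      qed
      have "ennreal (N / Z) \<le> ennreal (t / 2 * N + 1 / (2 * t) * (1 / Z))"
        using le_average_scaled[OF N0 NZ Z t] t Z by (intro ennreal_leI) (simp add: field_simps)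
      also have "\<dots> = ennreal (t / 2) * ennreal N + ennreal (1 / (2 * t)) * ennreal (1 / Z)"
        using t N0 Z by (simp add: ennreal_mult'[symmetric] ennreal_plus[symmetric] del: ennreal_plus)
      also have "\<dots> \<le> ennreal (t / 2) * ennreal N + ennreal (1 / (2 * t)) *
          (ennreal (1 / P\<^sup>2) * (\<integral>\<^sup>+ \<omega>. indicator A \<omega> * ennreal (exp (- v \<omega> D)) \<partial>\<Omega>))"
        using \<Omega>.inverse_integral_exp_le[OF _ A int] P Z unfolding Z_def P_def
        by (intro add_left_mono mult_left_mono) auto
      also have "ennreal N = (\<integral>\<^sup>+ \<omega>. indicator B' \<omega> * ennreal (exp (v \<omega> D)) \<partial>\<Omega>)"
      proof -
        have "(\<integral>\<^sup>+ \<omega>. ennreal (indicator B' \<omega> * exp (v \<omega> D)) \<partial>\<Omega>) = ennreal N"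
          unfolding N_def by (rule nn_integral_eq_integral[OF intB]) simp
        then show ?thesis by (simp add: ennreal_mult'' ennreal_indicator)
      qed
      also have "ennreal (1 / (2 * t)) * (ennreal (1 / P\<^sup>2) * (\<integral>\<^sup>+ \<omega>. indicator A \<omega> * ennreal (exp (- v \<omega> D)) \<partial>\<Omega>))
          = ennreal (1 / (2 * t * P\<^sup>2)) * (\<integral>\<^sup>+ \<omega>. indicator A \<omega> * ennreal (exp (- v \<omega> D)) \<partial>\<Omega>)"
        using t by (simp add: mult.assoc[symmetric] ennreal_mult'[symmetric])
      finally show ?thesis unfolding post .
    qed
    \<comment> \<open>After Fubini, every parameter in \<open>B'\<close> has divergence at least
      \<open>n * r\<close> by definition of the event, and the moment identity makes this
      exponentially small. No covering of the event is involved.\<close>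
    have num_bound: "(\<integral>\<^sup>+ D. (\<integral>\<^sup>+ \<omega>. indicator B' \<omega> * ennreal (exp (v \<omega> D)) \<partial>\<Omega>) \<partial>Q)
        \<le> ennreal (exp (- (1 - \<rho>) * real n * r))"
    proof -
      have "(\<integral>\<^sup>+ D. (\<integral>\<^sup>+ \<omega>. indicator B' \<omega> * ennreal (exp (v \<omega> D)) \<partial>\<Omega>) \<partial>Q)
          = (\<integral>\<^sup>+ \<omega>. (\<integral>\<^sup>+ D. indicator B' \<omega> * ennreal (exp (v \<omega> D)) \<partial>Q) \<partial>\<Omega>)"
        by (rule P.Fubini') measurable
      also have "\<dots> \<le> (\<integral>\<^sup>+ \<omega>. ennreal (exp (- (1 - \<rho>) * real n * r)) \<partial>\<Omega>)"
      proof (rule nn_integral_mono)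
        fix \<omega> assume \<omega>: "\<omega> \<in> space \<Omega>"
        show "(\<integral>\<^sup>+ D. indicator B' \<omega> * ennreal (exp (v \<omega> D)) \<partial>Q) \<le> ennreal (exp (- (1 - \<rho>) * real n * r))"
        proof (cases "\<omega> \<in> B'")
          case True
          then have TB: "T \<omega> \<in> B" by (simp add: B'_def)
          then have Tm: "T \<omega> \<in> borel_measurable PX"
            by (intro continuous_on_measurable_PX) (simp add: B_def space_cont_space)
          have "r * real n \<le> renyi_div \<rho> (sample_law PX n (T \<omega>)) Q"
            using TB n by (simp add: B_def field_simps)
          then have ren: "(1 - \<rho>) * (r * real n) \<le> (1 - \<rho>) * renyi_div \<rho> (sample_law PX n (T \<omega>)) Q"
            using \<rho> by (intro mult_left_mono) auto
          have "(\<integral>\<^sup>+ D. indicator B' \<omega> * ennreal (exp (v \<omega> D)) \<partial>Q)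
              = (\<integral>\<^sup>+ D. ennreal (exp (\<rho> * (loglik n D (T \<omega>) - loglik n D f0))) \<partial>Q)"
            using True by (intro nn_integral_cong) (simp add: v_T)
          also have "\<dots> \<le> ennreal (exp (- (1 - \<rho>) * renyi_div \<rho> (sample_law PX n (T \<omega>)) Q))"
            unfolding Q_def by (rule nn_integral_exp_loglik_le_renyi[OF Tm f0 \<rho>])
          also have "\<dots> \<le> ennreal (exp (- (1 - \<rho>) * real n * r))"
            using ren by (intro ennreal_leI) (simp add: algebra_simps)
          finally show ?thesis .
        qed simp
      qed
      also have "\<dots> = ennreal (exp (- (1 - \<rho>) * real n * r))"
        by (simp add: \<Omega>.emeasure_space_1)
      finally show ?thesis .
    qed
    \<comment> \<open>The factor \<open>P\<close> gained by integrating over \<open>A\<close>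
      cancels one of the two inverse powers of \<open>P\<close> from Cauchy-Schwarz, leaving
      \<open>1 / P \<le> exp c\<close>.\<close>
    have den_bound: "(\<integral>\<^sup>+ D. (\<integral>\<^sup>+ \<omega>. indicator A \<omega> * ennreal (exp (- v \<omega> D)) \<partial>\<Omega>) \<partial>Q)
        \<le> ennreal (P * exp (real n * \<rho> * \<eta>\<^sup>2))"
    proof -
      have "(\<integral>\<^sup>+ D. (\<integral>\<^sup>+ \<omega>. indicator A \<omega> * ennreal (exp (- v \<omega> D)) \<partial>\<Omega>) \<partial>Q)
          = (\<integral>\<^sup>+ \<omega>. (\<integral>\<^sup>+ D. indicator A \<omega> * ennreal (exp (- v \<omega> D)) \<partial>Q) \<partial>\<Omega>)"
        by (rule P.Fubini') measurable
      also have "\<dots> \<le> (\<integral>\<^sup>+ \<omega>. ennreal (exp (real n * \<rho> * \<eta>\<^sup>2)) * indicator A \<omega> \<partial>\<Omega>)"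
      proof (rule nn_integral_mono)
        fix \<omega> assume \<omega>: "\<omega> \<in> space \<Omega>"
        show "(\<integral>\<^sup>+ D. indicator A \<omega> * ennreal (exp (- v \<omega> D)) \<partial>Q)
            \<le> ennreal (exp (real n * \<rho> * \<eta>\<^sup>2)) * indicator A \<omega>"
        proof (cases "\<omega> \<in> A")
          case True
          have "T \<omega> \<in> space cont_space" using measurable_space[OF T_meas \<omega>] .
          then have Tm: "T \<omega> \<in> borel_measurable PX"
            by (intro continuous_on_measurable_PX) (simp add: space_cont_space)
          have "(\<integral>\<^sup>+ D. indicator A \<omega> * ennreal (exp (- v \<omega> D)) \<partial>Q)
              = (\<integral>\<^sup>+ D. ennreal (exp (- \<rho> * (loglik n D (T \<omega>) - loglik n D f0))) \<partial>Q)"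
            using True by (intro nn_integral_cong) (simp add: v_T)
          also have "\<dots> \<le> ennreal (exp (real n * \<rho> * \<eta>\<^sup>2))"
            unfolding Q_def
            by (rule nn_integral_exp_neg_loglik_le[OF Tm f0 \<rho>]) (use close[OF True] in \<open>simp add: T_def\<close>)
          finally show ?thesis using True by simp
        qed simp
      qed
      also have "\<dots> = ennreal (P * exp (real n * \<rho> * \<eta>\<^sup>2))"
        by (subst nn_integral_cmult_indicator)
          (simp_all add: P_def \<Omega>.emeasure_eq_measure ennreal_mult'[symmetric] mult.commute)
      finally show ?thesis .
    qed
    have [measurable]: "(\<lambda>D. \<integral>\<^sup>+ \<omega>. indicator B' \<omega> * ennreal (exp (v \<omega> D)) \<partial>\<Omega>) \<in> borel_measurable Q"
      "(\<lambda>D. \<integral>\<^sup>+ \<omega>. indicator A \<omega> * ennreal (exp (- v \<omega> D)) \<partial>\<Omega>) \<in> borel_measurable Q"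
    proof -
      have swap: "(\<lambda>p. v (snd p) (fst p)) \<in> borel_measurable (Q \<Otimes>\<^sub>M \<Omega>)"
        using measurable_compose[OF measurable_pair_swap' v_meas] by (simp add: case_prod_beta)
      have "(\<lambda>p. indicator B' (snd p) * ennreal (exp (v (snd p) (fst p)))) \<in> borel_measurable (Q \<Otimes>\<^sub>M \<Omega>)"
        by (intro borel_measurable_times_ennreal measurable_compose[OF swap, where g = "\<lambda>x. ennreal (exp x)"])
          measurable
      then show "(\<lambda>D. \<integral>\<^sup>+ \<omega>. indicator B' \<omega> * ennreal (exp (v \<omega> D)) \<partial>\<Omega>) \<in> borel_measurable Q"
        by (intro \<Omega>.borel_measurable_nn_integral) (simp add: case_prod_beta')
      have "(\<lambda>p. indicator A (snd p) * ennreal (exp (- v (snd p) (fst p)))) \<in> borel_measurable (Q \<Otimes>\<^sub>M \<Omega>)"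
        by (intro borel_measurable_times_ennreal measurable_compose[OF swap, where g = "\<lambda>x. ennreal (exp (- x))"])
          measurable
      then show "(\<lambda>D. \<integral>\<^sup>+ \<omega>. indicator A \<omega> * ennreal (exp (- v \<omega> D)) \<partial>\<Omega>) \<in> borel_measurable Q"
        by (intro \<Omega>.borel_measurable_nn_integral) (simp add: case_prod_beta')
    qed
    have "(\<integral>\<^sup>+ D. ennreal (rho_posterior \<rho> prior n D B) \<partial>Q)
        \<le> (\<integral>\<^sup>+ D. ennreal (t / 2) * (\<integral>\<^sup>+ \<omega>. indicator B' \<omega> * ennreal (exp (v \<omega> D)) \<partial>\<Omega>)
          + ennreal (1 / (2 * t * P\<^sup>2)) * (\<integral>\<^sup>+ \<omega>. indicator A \<omega> * ennreal (exp (- v \<omega> D)) \<partial>\<Omega>) \<partial>Q)"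
      by (rule nn_integral_mono) (rule pointwise)
    also have "\<dots> = ennreal (t / 2) * (\<integral>\<^sup>+ D. (\<integral>\<^sup>+ \<omega>. indicator B' \<omega> * ennreal (exp (v \<omega> D)) \<partial>\<Omega>) \<partial>Q)
        + ennreal (1 / (2 * t * P\<^sup>2)) * (\<integral>\<^sup>+ D. (\<integral>\<^sup>+ \<omega>. indicator A \<omega> * ennreal (exp (- v \<omega> D)) \<partial>\<Omega>) \<partial>Q)"
      by (simp add: nn_integral_add nn_integral_cmult)
    also have "\<dots> \<le> ennreal (t / 2) * ennreal (exp (- (1 - \<rho>) * real n * r))
        + ennreal (1 / (2 * t * P\<^sup>2)) * ennreal (P * exp (real n * \<rho> * \<eta>\<^sup>2))"
      by (intro add_mono mult_left_mono num_bound den_bound) auto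
    also have "\<dots> = ennreal (t / 2 * exp (- (1 - \<rho>) * real n * r)
        + 1 / (2 * t * P\<^sup>2) * (P * exp (real n * \<rho> * \<eta>\<^sup>2)))"
      using t P by (simp add: ennreal_mult'[symmetric] ennreal_plus[symmetric] del: ennreal_plus)
    also have "\<dots> \<le> ennreal m"
    proof (rule ennreal_leI)
      have first: "t / 2 * exp (- (1 - \<rho>) * real n * r) \<le> m / 2"
        unfolding t_def m_def by (simp add: mult_exp_exp field_simps)
      have second: "1 / (2 * t * P\<^sup>2) * (P * exp (real n * \<rho> * \<eta>\<^sup>2)) \<le> m / 2"
      proof -
        have "1 / P \<le> exp c"
          using mass P unfolding P_def[symmetric] by (simp add: exp_minus field_simps)
        then have "1 / P * exp (real n * \<rho> * \<eta>\<^sup>2) / t \<le> exp c * exp (real n * \<rho> * \<eta>\<^sup>2) / t"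
          using t by (intro divide_right_mono mult_right_mono) auto
        also have "\<dots> = m"
          unfolding t_def m_def by (simp add: mult_exp_exp field_simps flip: exp_diff)
        finally show ?thesis using P by (simp add: power2_eq_square field_simps)
      qed
      show "t / 2 * exp (- (1 - \<rho>) * real n * r)
        + 1 / (2 * t * P\<^sup>2) * (P * exp (real n * \<rho> * \<eta>\<^sup>2)) \<le> m"
        by (rule order_trans[OF add_mono[OF first second]]) simp
    qed
    \<comment> \<open>Passing to the Bochner integral is safe: a nonintegrable integrand has
      integral zero, and \<open>m\<close> is nonnegative.\<close>
    finally show ?thesis
      by (intro integral_real_bounded) (simp_all add: m_def)
  qed
  then show ?thesis unfolding goal_eq m_def .
qed

end

section \<open>Piecewise linear interpolation in Hoelder balls\<close>

lemma holder_order_cases: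
  assumes "0 < \<beta>" "\<beta> \<le> 2"
  shows "(\<beta> \<le> 1 \<and> holder_order \<beta> = 0) \<or> (1 < \<beta> \<and> holder_order \<beta> = 1)"
proof (cases "\<beta> \<le> 1")
  case True
  then have "\<lceil>\<beta>\<rceil> = 1" using assms by (intro ceiling_unique) auto
  then show ?thesis using True by (simp add: holder_order_def)
next
  case False
  then have "\<lceil>\<beta>\<rceil> = 2" using assms by (intro ceiling_unique) auto
  then show ?thesis using False by (simp add: holder_order_def)
qed

lemma holder_ball_iter_deriv_le:
  assumes f: "f \<in> holder_ball \<beta> L" and L: "0 \<le> L" and i: "i \<le> holder_order \<beta>" and x: "x \<in> {0..1}"
  shows "\<bar>iter_deriv i f x\<bar> \<le> L"
proof -
  define S where "S = (\<lambda>i. SUP x\<in>{0..1}. ennreal \<bar>iter_deriv i f x\<bar>)"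
  have "ennreal \<bar>iter_deriv i f x\<bar> \<le> S i"
    unfolding S_def by (rule SUP_upper[OF x])
  also have "S i \<le> Max (S ` {0..holder_order \<beta>})"
    using i by (intro Max_ge) auto
  also have "\<dots> \<le> holder_norm \<beta> f"
    unfolding holder_norm_def S_def by (rule add_increasing2) auto
  also have "\<dots> \<le> ennreal L"
    using f by (simp add: holder_ball_def)
  finally show ?thesis using L by simp
qed

lemma holder_ball_holder_le:
  assumes f: "f \<in> holder_ball \<beta> L" and L: "0 \<le> L" and x: "x \<in> {0..1}" and y: "y \<in> {0..1}"
  shows "\<bar>iter_deriv (holder_order \<beta>) f x - iter_deriv (holder_order \<beta>) f y\<bar>
    \<le> L * \<bar>x - y\<bar> powr (\<beta> - real (holder_order \<beta>))"
proof (cases "x = y")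
  case False
  define q where "q = (\<lambda>(x, y). ennreal (\<bar>iter_deriv (holder_order \<beta>) f x - iter_deriv (holder_order \<beta>) f y\<bar>
    / \<bar>x - y\<bar> powr (\<beta> - real (holder_order \<beta>))))"
  have "q (x, y) \<le> (SUP p\<in>{(x, y). x \<in> {0..1} \<and> y \<in> {0..1} \<and> x \<noteq> y}. q p)"
    using x y False by (intro SUP_upper) auto
  also have "\<dots> \<le> holder_norm \<beta> f"
    unfolding holder_norm_def q_def by (rule add_increasing) auto
  also have "\<dots> \<le> ennreal L"
    using f by (simp add: holder_ball_def)
  finally have "\<bar>iter_deriv (holder_order \<beta>) f x - iter_deriv (holder_order \<beta>) f y\<bar>
      / \<bar>x - y\<bar> powr (\<beta> - real (holder_order \<beta>)) \<le> L"
    using L by (simp add: q_def)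
  then show ?thesis using False by (simp add: divide_le_eq)
qed (use L in simp)

lemma iter_deriv_0 [simp]: "iter_deriv 0 f = f"
  by (simp add: iter_deriv_def)

lemma holder_ball_has_derivative:
  assumes f: "f \<in> holder_ball \<beta> L" and "0 < holder_order \<beta>" and x: "x \<in> {0..1}"
  shows "(f has_vector_derivative iter_deriv 1 f x) (at x within {0..1})"
proof -
  have "f differentiable_on {0..1}"
    using assms by (force simp: holder_ball_def)
  then have "f differentiable (at x within {0..1})"
    using x by (simp add: differentiable_on_def)
  then show ?thesis
    by (simp add: iter_deriv_def vector_derivative_works)
qed

lemma holder_ball_mvt:
  assumes f: "f \<in> holder_ball \<beta> L" and "0 < holder_order \<beta>" and xy: "0 \<le> x" "x < y" "y \<le> 1"
  obtains z where "x \<le> z" "z \<le> y" "f y - f x = iter_deriv 1 f z * (y - x)"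
proof -
  have "\<exists>z\<in>{x<..<y}. f y - f x = (\<lambda>h. h * iter_deriv 1 f z) (y - x)"
  proof (rule mvt_simple)
    fix z assume "x \<le> z" "z \<le> y"
    then have "(f has_vector_derivative iter_deriv 1 f z) (at z within {0..1})"
      using xy by (intro holder_ball_has_derivative[OF f]) (use assms in auto)
    then show "(f has_derivative (\<lambda>h. h * iter_deriv 1 f z)) (at z within {x..y})"
      using xy by (auto simp: has_vector_derivative_def intro: has_derivative_subset)
  qed (use xy in auto)
  then obtain z where "z \<in> {x<..<y}" "f y - f x = (y - x) * iter_deriv 1 f z"
    by blast
  then show ?thesis using that[of z] by (simp add: mult.commute)
qed

lemma holder_ball_continuous:
  assumes "0 < \<beta>" "\<beta> \<le> 2" "0 \<le> L" and f: "f \<in> holder_ball \<beta> L"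
  shows "continuous_on {0..1} f"
  using holder_order_cases[OF assms(1,2)]
proof
  assume \<beta>: "1 < \<beta> \<and> holder_order \<beta> = 1"
  then show ?thesis
    using holder_ball_has_derivative[OF f] by (intro continuous_on_vector_derivative) auto
next
  assume \<beta>: "\<beta> \<le> 1 \<and> holder_order \<beta> = 0"
  show ?thesis
    unfolding continuous_on
  proof
    fix x :: real assume x: "x \<in> {0..1}"
    have "((\<lambda>y. L * \<bar>y - x\<bar> powr \<beta>) \<longlongrightarrow> L * \<bar>x - x\<bar> powr \<beta>) (at x within {0..1})"
      using assms by (intro tendsto_intros) auto
    then have lim: "((\<lambda>y. L * \<bar>y - x\<bar> powr \<beta>) \<longlongrightarrow> 0) (at x within {0..1})" by simp
    have "((\<lambda>y. f y - f x) \<longlongrightarrow> 0) (at x within {0..1})"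
    proof (rule Lim_null_comparison[OF _ lim])
      show "\<forall>\<^sub>F y in at x within {0..1}. norm (f y - f x) \<le> L * \<bar>y - x\<bar> powr \<beta>"
        using holder_ball_holder_le[OF f \<open>0 \<le> L\<close> _ x] \<beta> by (auto simp: eventually_at_filter)
    qed
    then show "(f \<longlongrightarrow> f x) (at x within {0..1})" by (simp add: LIM_zero_iff)
  qed
qed

section \<open>The linear interpolant as a ReLU network\<close>

definition secant_slope :: "(real \<Rightarrow> real) \<Rightarrow> nat \<Rightarrow> nat \<Rightarrow> real" where
  "secant_slope f N k = real N * (f (real (Suc k) / real N) - f (real k / real N))"

text \<open>Slope changes of the linear interpolant at the knots. The first knot sits at the origin,
  where its ReLU is active on the whole interval, so its weight is the initial slope and no separate
  linear term is needed.\<close>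

definition interp_weight :: "(real \<Rightarrow> real) \<Rightarrow> nat \<Rightarrow> nat \<Rightarrow> real" where
  "interp_weight f N k =
     (if k = 0 then secant_slope f N 0 else secant_slope f N k - secant_slope f N (k - 1))"

text \<open>Summation by parts: the slope changes telescope to the current secant slope, and the
  knot terms telescope to the increment of \<open>f\<close> up to knot \<open>j\<close>.\<close>

lemma sum_interp_weight:
  assumes "0 < N"
  shows "(\<Sum>k\<le>j. interp_weight f N k * (x - real k / real N))
    = f (real j / real N) - f 0 + secant_slope f N j * (x - real j / real N)"
proof (induction j)
  case 0
  then show ?case by (simp add: interp_weight_def)
next
  case (Suc j)
  have "secant_slope f N j * (1 / real N) = f (real (Suc j) / real N) - f (real j / real N)"
    using assms by (simp add: secant_slope_def)
  then show ?case
    unfolding sum.atMost_Suc Suc.IH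
    by (simp add: interp_weight_def algebra_simps add_divide_distrib)
qed

lemma unit_interval_cell:
  fixes x :: real
  assumes "0 < N" "x \<in> {0..1}"
  obtains j where "j < N" "real j / real N \<le> x" "x \<le> real (Suc j) / real N"
proof (cases "x = 1")
  \<comment> \<open>At the right endpoint the floor would give the nonexistent cell
    \<open>N\<close>; the last cell is used instead.\<close>
  case True
  then show ?thesis using assms by (intro that[of "N - 1"]) (auto simp: of_nat_diff field_simps)
next
  case False
  define j where "j = nat \<lfloor>x * real N\<rfloor>"
  have xN: "0 \<le> x * real N" using assms by simp
  then have j: "real j \<le> x * real N" "x * real N \<le> real (Suc j)"
    unfolding j_def by linarith+
  moreover have "x * real N < real N" using False assms by simp
  ultimately have "real j < real N" by linarith
  then show ?thesis using assms j by (intro that[of j]) (simp_all add: field_simps)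
qed

text \<open>On cell \<open>j\<close> the units with knots to the right are inactive, while the
  others are active and lose their \<open>max\<close>.\<close>

lemma relu_net_interp_eq:
  assumes N: "0 < N" and j: "j < N" "real j / real N \<le> x" "x \<le> real (Suc j) / real N"
  shows "relu_net N (interp_weight f N) (f 0) x
    = f (real j / real N) + secant_slope f N j * (x - real j / real N)"
proof -
  have "(\<Sum>k<N. interp_weight f N k * max (x - real k / real N) 0)
      = (\<Sum>k\<le>j. interp_weight f N k * (x - real k / real N))"
  proof (rule sum.mono_neutral_cong_right)
    show "\<forall>k\<in>{..<N} - {..j}. interp_weight f N k * max (x - real k / real N) 0 = 0"
    proof
      fix k assume "k \<in> {..<N} - {..j}"
      then have "real (Suc j) / real N \<le> real k / real N"
        by (intro divide_right_mono) auto
      then show "interp_weight f N k * max (x - real k / real N) 0 = 0" using j by simp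
    qed
    fix k assume "k \<in> {..j}"
    then have "real k / real N \<le> real j / real N"
      by (intro divide_right_mono) auto
    then show "interp_weight f N k * max (x - real k / real N) 0 = interp_weight f N k * (x - real k / real N)"
      using j by simp
  qed (use j in auto)
  then show ?thesis
    unfolding relu_net_def sum_interp_weight[OF N] by simp
qed

text \<open>For \<beta> \<le> 1 the triangle inequality suffices. For \<beta> > 1 secant slopes are
  derivatives at intermediate points, so the Hoelder bound for the derivative controls both the
  error and the slope changes. The first weight is a slope, not a change of slope, hence its weaker
  bound.\<close>

lemma holder_ball_piecewise_linear:
  assumes \<beta>: "0 < \<beta>" "\<beta> \<le> 2" and L: "0 < L" and f: "f \<in> holder_ball \<beta> L" and N: "0 < N"
  shows "x \<in> {0..1} \<Longrightarrow> \<bar>relu_net N (interp_weight f N) (f 0) x - f x\<bar> \<le> 2 * L * real N powr - \<beta>"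
    and "\<bar>interp_weight f N 0\<bar> \<le> L * max 1 (real N powr (1 - \<beta>))"
    and "0 < k \<Longrightarrow> k < N \<Longrightarrow> \<bar>interp_weight f N k\<bar> \<le> 2 * L * real N powr (1 - \<beta>)"
proof -
  \<comment> \<open>Keeps right cell endpoints in the form \<open>real (Suc j) / real N\<close> in
    which the facts below are stated.\<close>
  note of_nat_Suc [simp del]
  define h where "h = 1 / real N"
  have h: "0 < h" "h \<le> 1" using N by (auto simp: h_def)
  have hb: "h powr c = real N powr - c" for c
    using N by (simp add: h_def powr_divide powr_minus_divide)
  have hN: "real N * h powr c = real N powr (1 - c)" for c
    using N unfolding hb by (simp add: powr_mult_base)
  have cell: "real (Suc j) / real N = real j / real N + h" for j
    by (simp add: h_def of_nat_Suc add_divide_distrib)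
  have grid: "0 \<le> real j / real N" "real (Suc j) / real N \<le> 1" if "j < N" for j
    using that N by (auto simp: divide_le_eq)
  \<comment> \<open>The three claims are proved together, cellwise, so that the distinction of the
    Hoelder order is made only once.\<close>
  have main: "(\<forall>j<N. \<forall>x. real j / real N \<le> x \<longrightarrow> x \<le> real (Suc j) / real N \<longrightarrow>
        \<bar>f (real j / real N) + secant_slope f N j * (x - real j / real N) - f x\<bar> \<le> 2 * L * h powr \<beta>)
      \<and> \<bar>interp_weight f N 0\<bar> \<le> L * max 1 (real N powr (1 - \<beta>))
      \<and> (\<forall>k. 0 < k \<longrightarrow> k < N \<longrightarrow> \<bar>interp_weight f N k\<bar> \<le> 2 * L * real N powr (1 - \<beta>))"
    using holder_order_cases[OF \<beta>]
  proof
    assume o: "\<beta> \<le> 1 \<and> holder_order \<beta> = 0"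
    have hol: "\<bar>f x - f y\<bar> \<le> L * h powr \<beta>" if "x \<in> {0..1}" "y \<in> {0..1}" "\<bar>x - y\<bar> \<le> h" for x y
    proof -
      have "\<bar>f x - f y\<bar> \<le> L * \<bar>x - y\<bar> powr \<beta>"
        using holder_ball_holder_le[OF f _ that(1,2)] L o by simp
      also have "\<dots> \<le> L * h powr \<beta>"
        using L that \<beta> by (intro mult_left_mono powr_mono2) auto
      finally show ?thesis .
    qed
    have diff: "\<bar>f (real (Suc j) / real N) - f (real j / real N)\<bar> \<le> L * h powr \<beta>" if "j < N" for j
      using grid[OF that] h by (intro hol) (auto simp: cell)
    have slope: "\<bar>secant_slope f N j\<bar> \<le> L * real N powr (1 - \<beta>)" if "j < N" for j
    proof -
      have "\<bar>secant_slope f N j\<bar> \<le> real N * (L * h powr \<beta>)"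
        unfolding secant_slope_def abs_mult using diff[OF that] by (intro mult_mono) auto
      also have "\<dots> = L * real N powr (1 - \<beta>)" by (simp flip: hN)
      finally show ?thesis .
    qed
    show ?thesis
    proof (intro conjI allI impI)
      fix j x assume j: "j < N" and x: "real j / real N \<le> x" "x \<le> real (Suc j) / real N"
      have 1: "\<bar>f x - f (real j / real N)\<bar> \<le> L * h powr \<beta>"
        using grid[OF j] x order_trans[OF grid(1)[OF j] x(1)] by (intro hol) (auto simp: cell)
      have "\<bar>secant_slope f N j * (x - real j / real N)\<bar>
          = \<bar>f (real (Suc j) / real N) - f (real j / real N)\<bar> * (real N * (x - real j / real N))"
        using x by (simp add: secant_slope_def abs_mult)
      also have "\<dots> \<le> (L * h powr \<beta>) * 1"
      proof (rule mult_mono[OF diff[OF j]])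
        have "x - real j / real N \<le> h" using x by (simp add: cell)
        then show "real N * (x - real j / real N) \<le> 1"
          using N unfolding h_def by (simp only: pos_le_divide_eq of_nat_0_less_iff mult.commute)
      qed (use x L in auto)
      finally show "\<bar>f (real j / real N) + secant_slope f N j * (x - real j / real N) - f x\<bar> \<le> 2 * L * h powr \<beta>"
        using 1 by linarith
    next
      have "\<bar>interp_weight f N 0\<bar> \<le> L * real N powr (1 - \<beta>)"
        using slope[OF N] by (simp add: interp_weight_def)
      also have "\<dots> \<le> L * max 1 (real N powr (1 - \<beta>))"
        using L by (intro mult_left_mono) auto
      finally show "\<bar>interp_weight f N 0\<bar> \<le> L * max 1 (real N powr (1 - \<beta>))" .
    next
      fix k assume k: "0 < k" "k < N"
      have "\<bar>secant_slope f N k - secant_slope f N (k - 1)\<bar> \<le> 2 * (L * real N powr (1 - \<beta>))"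
        using slope[of k] slope[of "k - 1"] k by linarith
      then show "\<bar>interp_weight f N k\<bar> \<le> 2 * L * real N powr (1 - \<beta>)"
        using k by (simp add: interp_weight_def mult.assoc)
    qed
  next
    assume o: "1 < \<beta> \<and> holder_order \<beta> = 1"
    have hol: "\<bar>iter_deriv 1 f x - iter_deriv 1 f y\<bar> \<le> L * d powr (\<beta> - 1)"
      if "x \<in> {0..1}" "y \<in> {0..1}" "\<bar>x - y\<bar> \<le> d" for x y d
    proof -
      have "\<bar>iter_deriv 1 f x - iter_deriv 1 f y\<bar> \<le> L * \<bar>x - y\<bar> powr (\<beta> - 1)"
        using holder_ball_holder_le[OF f _ that(1,2)] L o by (simp add: of_nat_Suc)
      also have "\<dots> \<le> L * d powr (\<beta> - 1)"
        using L that o by (intro mult_left_mono powr_mono2) auto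
      finally show ?thesis .
    qed
    have slope: "\<exists>z. real j / real N \<le> z \<and> z \<le> real (Suc j) / real N \<and> secant_slope f N j = iter_deriv 1 f z"
      if j: "j < N" for j
    proof -
      have "real j / real N < real (Suc j) / real N" unfolding cell using h by simp
      then obtain z where z: "real j / real N \<le> z" "z \<le> real (Suc j) / real N"
        "f (real (Suc j) / real N) - f (real j / real N)
          = iter_deriv 1 f z * (real (Suc j) / real N - real j / real N)"
        using holder_ball_mvt[OF f, of "real j / real N" "real (Suc j) / real N"] grid[OF j] o by auto
      have "secant_slope f N j = iter_deriv 1 f z"
        unfolding secant_slope_def z(3) unfolding cell using N by (simp add: h_def)
      then show ?thesis using z by blast
    qed
    show ?thesis
    proof (intro conjI allI impI)
      fix j x assume j: "j < N" and x: "real j / real N \<le> x" "x \<le> real (Suc j) / real N"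
      define a where "a = real j / real N"
      obtain z where z: "a \<le> z" "z \<le> a + h" "secant_slope f N j = iter_deriv 1 f z"
        using slope[OF j] by (auto simp: a_def cell)
      have a: "0 \<le> a" "a + h \<le> 1" using grid[OF j] by (auto simp: a_def cell)
      have x': "a \<le> x" "x \<le> a + h" using x by (auto simp: a_def cell)
      have "\<bar>f a + secant_slope f N j * (x - a) - f x\<bar> \<le> L * h powr \<beta>"
      proof (cases "x = a")
        case False
        then obtain z' where z': "a \<le> z'" "z' \<le> x" "f x - f a = iter_deriv 1 f z' * (x - a)"
          using holder_ball_mvt[OF f, of a x] a x' o by auto
        \<comment> \<open>Two applications of the mean value theorem, on the cell and on its part
          left of \<open>x\<close>, express the error as a difference of derivatives times a length
          of at most \<open>h\<close>.\<close>
        have "f a + secant_slope f N j * (x - a) - f x = (iter_deriv 1 f z - iter_deriv 1 f z') * (x - a)"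
          using z'(3) by (simp add: z(3) algebra_simps)
        also have "\<bar>\<dots>\<bar> \<le> (L * h powr (\<beta> - 1)) * h"
          unfolding abs_mult using z z' a x' L by (intro mult_mono hol) auto
        also have "\<dots> = L * h powr \<beta>" using h by (simp add: powr_diff)
        finally show ?thesis .
      qed (use L in simp)
      also have "\<dots> \<le> 2 * L * h powr \<beta>" using L by simp
      finally show "\<bar>f (real j / real N) + secant_slope f N j * (x - real j / real N) - f x\<bar> \<le> 2 * L * h powr \<beta>"
        unfolding a_def .
    next
      obtain z where z: "0 \<le> z" "z \<le> h" "secant_slope f N 0 = iter_deriv 1 f z"
        using slope[OF N] by (auto simp: cell)
      then have "\<bar>interp_weight f N 0\<bar> \<le> L * 1"
        using holder_ball_iter_deriv_le[OF f, of 1 z] L o h by (simp add: interp_weight_def)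
      also have "\<dots> \<le> L * max 1 (real N powr (1 - \<beta>))"
        using L by (intro mult_left_mono) auto
      finally show "\<bar>interp_weight f N 0\<bar> \<le> L * max 1 (real N powr (1 - \<beta>))" .
    next
      fix k assume k: "0 < k" "k < N"
      obtain z where z: "real k / real N \<le> z" "z \<le> real k / real N + h" "secant_slope f N k = iter_deriv 1 f z"
        using slope[OF k(2)] by (auto simp: cell)
      have k1: "k - 1 < N" "real k / real N = real (k - 1) / real N + h"
        using k cell[of "k - 1"] by auto
      obtain z' where z': "real (k - 1) / real N \<le> z'" "z' \<le> real (k - 1) / real N + h"
          "secant_slope f N (k - 1) = iter_deriv 1 f z'"
        using slope[OF k1(1)] by (auto simp: cell)
      \<comment> \<open>The intermediate points lie in adjacent cells, hence at distance at most
        \<open>2 * h\<close>; the resulting factor \<open>2 powr (\<beta> - 1)\<close> is at most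
        2.\<close>
      have "0 \<le> z" "z \<le> 1" "0 \<le> z'" "z' \<le> 1" "\<bar>z - z'\<bar> \<le> 2 * h"
        using z(1,2) z'(1,2) grid(1)[OF k(2)] grid(2)[OF k(2), unfolded cell] grid(1)[OF k1(1)] k1(2) h
        by linarith+
      then have "\<bar>iter_deriv 1 f z - iter_deriv 1 f z'\<bar> \<le> L * (2 * h) powr (\<beta> - 1)"
        by (intro hol) auto
      also have "\<dots> \<le> L * (2 * h powr (\<beta> - 1))"
      proof -
        have "2 powr (\<beta> - 1) \<le> 2 powr (1 :: real)" using \<beta> by (intro powr_mono) auto
        then show ?thesis using L by (intro mult_left_mono) (auto simp: powr_mult intro!: mult_right_mono)
      qed
      also have "\<dots> = 2 * L * real N powr (1 - \<beta>)" by (simp add: hb)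
      finally show "\<bar>interp_weight f N k\<bar> \<le> 2 * L * real N powr (1 - \<beta>)"
        using k z(3) z'(3) by (simp add: interp_weight_def)
    qed
  qed
  show "\<bar>relu_net N (interp_weight f N) (f 0) x - f x\<bar> \<le> 2 * L * real N powr - \<beta>" if x: "x \<in> {0..1}"
  proof -
    obtain j where j: "j < N" "real j / real N \<le> x" "x \<le> real (Suc j) / real N"
      using unit_interval_cell[OF N x] .
    then show ?thesis
      using main unfolding relu_net_interp_eq[OF N j] hb by blast
  qed
  show "\<bar>interp_weight f N 0\<bar> \<le> L * max 1 (real N powr (1 - \<beta>))"
    using main by blast
  show "\<bar>interp_weight f N k\<bar> \<le> 2 * L * real N powr (1 - \<beta>)" if "0 < k" "k < N"
    using main that by blast
qed

section \<open>Small-ball mass of the network prior\<close>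

lemma prob_space_prob_density:
  assumes "prob_density h"
  shows "prob_space (density lborel (\<lambda>t. ennreal (h t)))"
  using assms by (intro prob_spaceI) (auto simp: prob_density_def emeasure_density cong: nn_integral_cong)

lemma measure_prob_density:
  assumes h: "prob_density h" and [measurable]: "A \<in> sets borel"
  shows "measure (density lborel (\<lambda>t. ennreal (h t))) A = (LINT t:A|lborel. h t)"
proof -
  have [measurable]: "h \<in> borel_measurable borel" and "\<And>t. 0 \<le> h t"
    using h by (auto simp: prob_density_def)
  interpret H: prob_space "density lborel (\<lambda>t. ennreal (h t))"
    by (rule prob_space_prob_density[OF h])
  have "H.prob A = (\<integral>t. indicator A t \<partial>density lborel (\<lambda>t. ennreal (h t)))"
    by simp
  also have "\<dots> = (\<integral>t. h t *\<^sub>R indicator A t \<partial>lborel)"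
    using \<open>\<And>t. 0 \<le> h t\<close> by (intro integral_density) auto
  finally show ?thesis
    by (simp add: set_lebesgue_integral_def mult.commute)
qed

lemma measure_prob_density_Icc_ge:
  assumes h: "prob_density h" and lower: "\<And>t. t \<in> {a..b} \<Longrightarrow> c \<le> h t" and "0 \<le> c" "a \<le> b"
  shows "c * (b - a) \<le> measure (density lborel (\<lambda>t. ennreal (h t))) {a..b}"
proof -
  have [measurable]: "h \<in> borel_measurable borel"
    using h by (auto simp: prob_density_def)
  interpret H: prob_space "density lborel (\<lambda>t. ennreal (h t))"
    by (rule prob_space_prob_density[OF h])
  have "ennreal (c * (b - a)) = (\<integral>\<^sup>+ t. ennreal c * indicator {a..b} t \<partial>lborel)"
    using assms by (simp add: nn_integral_cmult_indicator ennreal_mult)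
  also have "\<dots> \<le> (\<integral>\<^sup>+ t. ennreal (h t) * indicator {a..b} t \<partial>lborel)"
    using lower by (intro nn_integral_mono) (auto simp: indicator_def intro!: ennreal_leI)
  also have "\<dots> = ennreal (H.prob {a..b})"
    by (simp add: emeasure_density flip: H.emeasure_eq_measure)
  finally show ?thesis by simp
qed

text \<open>Reflection and symmetry of \<open>h\<close> equate the lower tail with the upper one,
  whence the factor 2.\<close>

lemma exp_tails_central_mass:
  assumes h: "prob_density h" and tails: "exp_tails p q h"
  obtains d0 d1 M0 where "0 < d0" "0 < d1" "0 < M0"
    "\<forall>x\<ge>M0. 1 - 2 * d0 * exp (- d1 * x powr q) \<le> measure (density lborel (\<lambda>t. ennreal (h t))) {- x..x}"
proof -
  have sym: "h (- t) = h t" for t using tails by (simp add: exp_tails_def)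
  obtain d0 d1 M0 where d: "0 < d0" "0 < d1" "0 < M0"
    and tail: "\<And>x. M0 \<le> x \<Longrightarrow> (LINT t:{x..}|lborel. h t) \<le> d0 * exp (- d1 * x powr q)"
    using tails unfolding exp_tails_def by blast
  interpret H: prob_space "density lborel (\<lambda>t. ennreal (h t))"
    by (rule prob_space_prob_density[OF h])
  have "1 - 2 * d0 * exp (- d1 * x powr q) \<le> H.prob {- x..x}" if x: "M0 \<le> x" for x
  proof -
    have "(LINT t:{..- x}|lborel. h t) = (LINT t:{x..}|lborel. h t)"
      using lborel_integral_real_affine[of "- 1" "\<lambda>t. indicator {..- x} t *\<^sub>R h t" 0] sym
      by (simp add: set_lebesgue_integral_def indicator_def)
    then have neg: "H.prob {..- x} = H.prob {x..}"
      by (simp add: measure_prob_density[OF h])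
    have pos: "H.prob {x..} \<le> d0 * exp (- d1 * x powr q)"
      using tail[OF x] by (simp add: measure_prob_density[OF h])
    have "1 = H.prob ({..- x} \<union> {- x..x} \<union> {x..})"
    proof -
      have "{..- x} \<union> {- x..x} \<union> {x..} = UNIV" using x d by auto
      then show ?thesis using H.prob_space by simp
    qed
    also have "\<dots> \<le> H.prob {..- x} + H.prob {- x..x} + H.prob {x..}"
      by (rule order_trans[OF measure_Un_le add_right_mono[OF measure_Un_le]]) auto
    finally show ?thesis using neg pos by simp
  qed
  then show ?thesis using that d by blast
qed

text \<open>On the window \<open>\<bar>s\<bar> \<le> 2 * max 1 \<bar>t\<bar>\<close>, so p \<le> 1
  gives \<open>\<bar>s\<bar> powr p \<le> 2 * (1 + \<bar>t\<bar> powr p)\<close>. This doubles the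
  constant in the exponent; the window length 2 doubles the prefactor.\<close>

lemma exp_tails_unit_ball_mass:
  assumes h: "prob_density h" and tails: "exp_tails p q h" and p: "0 < p" "p \<le> 1"
  obtains c0 c1 where "0 < c0" "0 < c1"
    "\<forall>t. c0 * exp (- c1 * (1 + \<bar>t\<bar> powr p)) \<le> measure (density lborel (\<lambda>t. ennreal (h t))) {t - 1..t + 1}"
proof -
  have sym: "h (- t) = h t" for t using tails by (simp add: exp_tails_def)
  obtain c0 c1 where c: "0 < c0" "0 < c1" and lower: "\<And>t. 0 \<le> t \<Longrightarrow> c0 * exp (- c1 * t powr p) \<le> h t"
    using tails unfolding exp_tails_def by blast
  have "2 * c0 * exp (- (2 * c1) * (1 + \<bar>t\<bar> powr p)) \<le> measure (density lborel (\<lambda>t. ennreal (h t))) {t - 1..t + 1}" for t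
  proof -
    have "c0 * exp (- (2 * c1) * (1 + \<bar>t\<bar> powr p)) \<le> h s" if s: "s \<in> {t - 1..t + 1}" for s
    proof -
      have "\<bar>s\<bar> powr p \<le> (2 * max 1 \<bar>t\<bar>) powr p"
        using s p by (intro powr_mono2) (auto simp: max_def abs_le_iff)
      also have "\<dots> = 2 powr p * max 1 \<bar>t\<bar> powr p"
        by (simp add: powr_mult)
      also have "\<dots> \<le> 2 * (1 + \<bar>t\<bar> powr p)"
      proof (rule mult_mono)
        show "2 powr p \<le> 2" using powr_mono[of p 1 2] p by simp
        show "max 1 \<bar>t\<bar> powr p \<le> 1 + \<bar>t\<bar> powr p" by (simp add: max_def)
      qed auto
      finally have "c1 * \<bar>s\<bar> powr p \<le> c1 * (2 * (1 + \<bar>t\<bar> powr p))"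
        using c by (intro mult_left_mono) auto
      then have "c0 * exp (- (2 * c1) * (1 + \<bar>t\<bar> powr p)) \<le> c0 * exp (- c1 * \<bar>s\<bar> powr p)"
        using c by (simp add: algebra_simps)
      also have "\<dots> \<le> h \<bar>s\<bar>" by (rule lower) simp
      also have "h \<bar>s\<bar> = h s" using sym[of s] by (simp add: abs_if)
      finally show ?thesis .
    qed
    then have "c0 * exp (- (2 * c1) * (1 + \<bar>t\<bar> powr p)) * ((t + 1) - (t - 1))
        \<le> measure (density lborel (\<lambda>t. ennreal (h t))) {t - 1..t + 1}"
      using c by (intro measure_prob_density_Icc_ge[OF h]) auto
    then show ?thesis by (simp add: mult.commute mult.left_commute)
  qed
  then show ?thesis using c by (intro that[of "2 * c0" "2 * c1"]) auto
qed

text \<open>By compactness the density has a positive minimum on the unit neighbourhood of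
  \<open>b0\<close>; the constant is twice this minimum.\<close>

lemma positive_density_ball_mass:
  assumes g: "prob_density g" "continuous_on UNIV g" "\<And>t. 0 < g t"
  obtains c where "0 < c"
    "\<forall>\<delta>\<in>{0..1}. c * \<delta> \<le> measure (density lborel (\<lambda>t. ennreal (g t))) {b0 - \<delta>..b0 + \<delta>}"
proof -
  have "\<exists>z\<in>{b0 - 1..b0 + 1}. \<forall>t\<in>{b0 - 1..b0 + 1}. g z \<le> g t"
    using g(2) by (intro continuous_attains_inf) (auto intro: continuous_on_subset)
  then obtain z where z: "\<And>t. t \<in> {b0 - 1..b0 + 1} \<Longrightarrow> g z \<le> g t" by blast
  have "2 * g z * \<delta> \<le> measure (density lborel (\<lambda>t. ennreal (g t))) {b0 - \<delta>..b0 + \<delta>}"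
    if "0 \<le> \<delta>" "\<delta> \<le> 1" for \<delta>
    using measure_prob_density_Icc_ge[OF g(1), of "b0 - \<delta>" "b0 + \<delta>" "g z"] z g(3)[of z] that
    by (simp add: mult.commute mult.left_commute)
  then show ?thesis using g(3)[of z] by (intro that[of "2 * g z"]) auto
qed

section \<open>Embedding of a coarse network into a finer one\<close>

lemma multiples_lessThan_mult:
  assumes "0 < (m :: nat)"
  shows "{k \<in> {..<m * N}. m dvd k} = (\<lambda>j. m * j) ` {..<N}"
  using assms by (auto elim!: dvdE)

text \<open>Coarse knot \<open>j / N\<close> is fine knot \<open>m * j / (m * N)\<close>. This is
  where divisibility of the widths enters: both networks then differ only in their weights.\<close>

lemma relu_net_refine:
  assumes m: "0 < m"
  shows "relu_net N w b x = relu_net (m * N) (\<lambda>k. if m dvd k then w (k div m) else 0) b x"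
proof -
  have "(\<Sum>k<m * N. (if m dvd k then w (k div m) else 0) * max (x - real k / real (m * N)) 0)
      = (\<Sum>k\<in>{k \<in> {..<m * N}. m dvd k}. w (k div m) * max (x - real k / real (m * N)) 0)"
    by (rule sum.mono_neutral_cong_right) auto
  also have "\<dots> = (\<Sum>j<N. w j * max (x - real j / real N) 0)"
    unfolding multiples_lessThan_mult[OF m] using m
    by (subst sum.reindex) (auto simp: inj_on_def)
  finally show ?thesis by (simp add: relu_net_def)
qed

lemma relu_net_diff_le:
  assumes "\<And>k. k < N \<Longrightarrow> \<bar>v k - w k\<bar> \<le> d" and x: "x \<in> {0..1}" and b: "\<bar>b - c\<bar> \<le> \<delta>"
  shows "\<bar>relu_net N v b x - relu_net N w c x\<bar> \<le> real N * d + \<delta>"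
proof -
  have "\<bar>\<Sum>k<N. (v k - w k) * max (x - real k / real N) 0\<bar> \<le> (\<Sum>k<N. d)"
  proof (rule order_trans[OF sum_abs sum_mono])
    fix k assume k: "k \<in> {..<N}"
    have "\<bar>v k - w k\<bar> * \<bar>max (x - real k / real N) 0\<bar> \<le> d * 1"
    proof (rule mult_mono)
      show "\<bar>v k - w k\<bar> \<le> d" using k assms(1) by simp
      then show "0 \<le> d" by linarith
      have "0 \<le> real k / real N" by simp
      then show "\<bar>max (x - real k / real N) 0\<bar> \<le> 1" using x unfolding atLeastAtMost_iff by linarith
    qed simp
    then show "\<bar>(v k - w k) * max (x - real k / real N) 0\<bar> \<le> d" by (simp add: abs_mult)
  qed
  moreover have "relu_net N v b x - relu_net N w c x
      = (\<Sum>k<N. (v k - w k) * max (x - real k / real N) 0) + (b - c)"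
    by (simp add: relu_net_def left_diff_distrib sum_subtractf)
  ultimately show ?thesis using b by simp
qed

text \<open>The joint law of unscaled weights and offset, of which \<open>relu_prior\<close> is the
  image. Small-ball events are taken here, as boxes of explicit mass, rather than in function
  space.\<close>

definition relu_param :: "nat \<Rightarrow> (real \<Rightarrow> real) \<Rightarrow> (real \<Rightarrow> real) \<Rightarrow> ((nat \<Rightarrow> real) \<times> real) measure" where
  "relu_param N h g = PiM {..<N} (\<lambda>_. density lborel (\<lambda>t. ennreal (h t)))
     \<Otimes>\<^sub>M density lborel (\<lambda>t. ennreal (g t))"

lemma sets_relu_param [measurable_cong]:
  "sets (relu_param N h g) = sets (PiM {..<N} (\<lambda>_. borel) \<Otimes>\<^sub>M borel)"
  unfolding relu_param_def by (intro sets_pair_measure_cong sets_PiM_cong) auto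

lemma relu_prior_eq:
  "relu_prior N \<sigma> h g = distr (relu_param N h g) cont_space
    (\<lambda>\<omega>. restrict (relu_net N (\<lambda>k. \<sigma> * fst \<omega> k) (snd \<omega>)) {0..1})"
  by (simp add: relu_prior_def relu_param_def case_prod_beta')

lemma prob_space_relu_param:
  assumes "prob_density h" "prob_density g"
  shows "prob_space (relu_param N h g)"
proof -
  interpret H: prob_space "density lborel (\<lambda>t. ennreal (h t))"
    by (rule prob_space_prob_density[OF assms(1)])
  interpret G: prob_space "density lborel (\<lambda>t. ennreal (g t))"
    by (rule prob_space_prob_density[OF assms(2)])
  interpret PH: prob_space "PiM {..<N} (\<lambda>_. density lborel (\<lambda>t. ennreal (h t)))"
    by (rule prob_space_PiM) (rule H.prob_space_axioms)
  interpret P: pair_prob_space "PiM {..<N} (\<lambda>_. density lborel (\<lambda>t. ennreal (h t)))"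
    "density lborel (\<lambda>t. ennreal (g t))" ..
  show ?thesis unfolding relu_param_def by (rule P.prob_space_axioms)
qed

lemma relu_net_measurable_pair:
  assumes [measurable]: "(\<lambda>x. x) \<in> borel_measurable M"
  shows "(\<lambda>p. relu_net N (\<lambda>k. \<sigma> * fst (fst p) k) (snd (fst p)) (snd p))
    \<in> borel_measurable (relu_param N h g \<Otimes>\<^sub>M M)"
  unfolding relu_net_def by measurable

lemma relu_net_measurable_cont_space:
  "(\<lambda>\<omega>. restrict (relu_net N (\<lambda>k. \<sigma> * fst \<omega> k) (snd \<omega>)) {0..1})
    \<in> relu_param N h g \<rightarrow>\<^sub>M cont_space"
  unfolding cont_space_def
proof (rule measurable_restrict_space2)
  have "continuous_on {0..1} (relu_net N w b)" for w b
    unfolding relu_net_def by (intro continuous_intros)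
  then show "(\<lambda>\<omega>. restrict (relu_net N (\<lambda>k. \<sigma> * fst \<omega> k) (snd \<omega>)) {0..1})
      \<in> space (relu_param N h g) \<rightarrow> {f. continuous_on {0..1} f}"
    by (auto intro!: iffD1[OF continuous_on_cong[OF refl restrict_apply'[symmetric]]])
  show "(\<lambda>\<omega>. restrict (relu_net N (\<lambda>k. \<sigma> * fst \<omega> k) (snd \<omega>)) {0..1})
      \<in> relu_param N h g \<rightarrow>\<^sub>M PiM {0..1} (\<lambda>_. borel)"
    by (rule measurable_restrict) (unfold relu_net_def, measurable)
qed

lemma relu_param_box_mass:
  assumes h: "prob_density h" and g: "prob_density g"
    and I: "\<And>k. k < N \<Longrightarrow> I k \<in> sets borel" and J: "J \<in> sets borel"
  shows "measure (relu_param N h g) (PiE {..<N} I \<times> J)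
    = (\<Prod>k<N. measure (density lborel (\<lambda>t. ennreal (h t))) (I k)) * measure (density lborel (\<lambda>t. ennreal (g t))) J"
proof -
  interpret H: prob_space "density lborel (\<lambda>t. ennreal (h t))"
    by (rule prob_space_prob_density[OF h])
  interpret G: prob_space "density lborel (\<lambda>t. ennreal (g t))"
    by (rule prob_space_prob_density[OF g])
  interpret PH: product_prob_space "\<lambda>_ :: nat. density lborel (\<lambda>t. ennreal (h t))" "{..<N}" ..
  have "emeasure (relu_param N h g) (PiE {..<N} I \<times> J)
      = emeasure (PiM {..<N} (\<lambda>_. density lborel (\<lambda>t. ennreal (h t)))) (PiE {..<N} I)
        * emeasure (density lborel (\<lambda>t. ennreal (g t))) J"
    unfolding relu_param_def using I J
    by (intro G.emeasure_pair_measure_Times sets_PiM_I_finite) auto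
  also have "emeasure (PiM {..<N} (\<lambda>_. density lborel (\<lambda>t. ennreal (h t)))) (PiE {..<N} I)
      = (\<Prod>k<N. emeasure (density lborel (\<lambda>t. ennreal (h t))) (I k))"
    using I by (intro PH.emeasure_PiM) auto
  also have "\<dots> = ennreal (\<Prod>k<N. H.prob (I k))"
    by (simp add: H.emeasure_eq_measure prod_ennreal)
  finally have "emeasure (relu_param N h g) (PiE {..<N} I \<times> J) = ennreal ((\<Prod>k<N. H.prob (I k)) * G.prob J)"
    by (simp add: G.emeasure_eq_measure ennreal_mult prod_nonneg)
  then show ?thesis
    by (simp add: measure_def prod_nonneg)
qed

text \<open>Only indices that are not multiples of \<open>m\<close> contribute a factor \<tau>;
  raising it to the full count \<open>m * N\<close> only decreases the left side as \<tau> \<le>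
  1.\<close>

lemma prod_multiples_ge:
  fixes a :: "nat \<Rightarrow> real"
  assumes m: "0 < m" and a: "\<And>j. j < N \<Longrightarrow> 0 \<le> a j" and \<tau>: "0 \<le> \<tau>" "\<tau> \<le> 1"
  shows "(\<Prod>j<N. a j) * \<tau> ^ (m * N) \<le> (\<Prod>k<m * N. if m dvd k then a (k div m) else \<tau>)"
proof -
  have split: "(\<Prod>k<m * N. if m dvd k then a (k div m) else \<tau>)
      = (\<Prod>k\<in>{k \<in> {..<m * N}. m dvd k}. a (k div m)) * (\<Prod>k\<in>{k \<in> {..<m * N}. \<not> m dvd k}. \<tau>)"
    by (simp only: prod.If_cases[OF finite_lessThan] Compl_eq mem_Collect_eq Int_def)
  have on: "(\<Prod>k\<in>{k \<in> {..<m * N}. m dvd k}. a (k div m)) = (\<Prod>j<N. a j)"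
    unfolding multiples_lessThan_mult[OF m] using m by (subst prod.reindex) (auto simp: inj_on_def)
  have off: "\<tau> ^ (m * N) \<le> (\<Prod>k\<in>{k \<in> {..<m * N}. \<not> m dvd k}. \<tau>)"
  proof -
    have "card {k \<in> {..<m * N}. \<not> m dvd k} \<le> card {..<m * N}"
      by (rule card_mono) auto
    then show ?thesis using \<tau> by (simp add: power_decreasing)
  qed
  show ?thesis
    unfolding split on using a by (intro mult_left_mono[OF off] prod_nonneg) auto
qed

text \<open>The weights at the knots of the coarse grid are matched up to one unit of their scale, all other
  weights are merely kept below the threshold \<open>T\<close>.\<close>

lemma relu_param_small_ball:
  fixes w a :: "nat \<Rightarrow> real"
  assumes h: "prob_density h" and g: "prob_density g" and m: "0 < m" and \<sigma>: "0 < \<sigma>" and T: "1 \<le> T"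
    and a: "\<And>j. j < N \<Longrightarrow> 0 \<le> a j"
      "\<And>j. j < N \<Longrightarrow> a j \<le> measure (density lborel (\<lambda>t. ennreal (h t))) {w j / \<sigma> - 1..w j / \<sigma> + 1}"
    and \<tau>: "0 \<le> \<tau>" "\<tau> \<le> measure (density lborel (\<lambda>t. ennreal (h t))) {- T..T}"
    and \<gamma>: "0 \<le> \<gamma>" "\<gamma> \<le> measure (density lborel (\<lambda>t. ennreal (g t))) {b0 - \<delta>..b0 + \<delta>}"
  obtains A where "A \<in> sets (relu_param (m * N) h g)"
    "(\<Prod>j<N. a j) * \<tau> ^ (m * N) * \<gamma> \<le> measure (relu_param (m * N) h g) A"
    "\<forall>\<omega>\<in>A. \<forall>x\<in>{0..1}.
       \<bar>relu_net (m * N) (\<lambda>k. \<sigma> * fst \<omega> k) (snd \<omega>) x - relu_net N w b0 x\<bar> \<le> real (m * N) * (\<sigma> * T) + \<delta>"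
proof -
  interpret H: prob_space "density lborel (\<lambda>t. ennreal (h t))"
    by (rule prob_space_prob_density[OF h])
  define I where "I = (\<lambda>k. if m dvd k then {w (k div m) / \<sigma> - 1..w (k div m) / \<sigma> + 1} else {- T..T})"
  define J where "J = {b0 - \<delta>..b0 + \<delta>}"
  define A where "A = PiE {..<m * N} I \<times> J"
  have [measurable]: "I k \<in> sets borel" for k by (simp add: I_def)
  have A: "A \<in> sets (relu_param (m * N) h g)"
    unfolding A_def sets_relu_param J_def by (intro pair_measureI sets_PiM_I_finite) auto
  have div: "k div m < N" if "k < m * N" for k
    using that by (simp add: less_mult_imp_div_less mult.commute)
  have mass: "(\<Prod>j<N. a j) * \<tau> ^ (m * N) * \<gamma> \<le> measure (relu_param (m * N) h g) A"
  proof -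
    have "\<tau> \<le> 1" using \<tau>(2) H.prob_le_1 order_trans by blast
    have "(\<Prod>j<N. a j) * \<tau> ^ (m * N) \<le> (\<Prod>k<m * N. if m dvd k then a (k div m) else \<tau>)"
      by (rule prod_multiples_ge[OF m a(1) \<tau>(1) \<open>\<tau> \<le> 1\<close>])
    also have "\<dots> \<le> (\<Prod>k<m * N. H.prob (I k))"
      using a \<tau> div by (intro prod_mono) (auto simp: I_def)
    finally show ?thesis
      unfolding A_def J_def using \<gamma>
      by (subst relu_param_box_mass[OF h g]) (auto intro!: mult_mono prod_nonneg)
  qed
  have close: "\<bar>relu_net (m * N) (\<lambda>k. \<sigma> * fst \<omega> k) (snd \<omega>) x - relu_net N w b0 x\<bar> \<le> real (m * N) * (\<sigma> * T) + \<delta>"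
    if \<omega>: "\<omega> \<in> A" and x: "x \<in> {0..1}" for \<omega> x
  proof -
    have \<omega>1: "fst \<omega> \<in> PiE {..<m * N} I" and \<omega>2: "snd \<omega> \<in> J"
      using \<omega> by (simp_all add: A_def mem_Times_iff)
    have b: "\<bar>snd \<omega> - b0\<bar> \<le> \<delta>" using \<omega>2 unfolding J_def atLeastAtMost_iff by linarith
    \<comment> \<open>Since \<open>1 \<le> T\<close>, the unit window at the matched knots obeys the
      same bound as the threshold at all others.\<close>
    have "\<bar>\<sigma> * fst \<omega> k - (if m dvd k then w (k div m) else 0)\<bar> \<le> \<sigma> * T"
      if "k < m * N" for k
    proof (cases "m dvd k")
      case True
      have k: "fst \<omega> k \<in> I k" using \<omega>1 that by (rule PiE_mem[OF _ lessThan_iff[THEN iffD2]])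
      from True have "\<bar>fst \<omega> k - w (k div m) / \<sigma>\<bar> \<le> T" using k T by (auto simp: I_def abs_le_iff)
      then have "\<sigma> * \<bar>fst \<omega> k - w (k div m) / \<sigma>\<bar> \<le> \<sigma> * T" using \<sigma> by (intro mult_left_mono) auto
      also have "\<sigma> * \<bar>fst \<omega> k - w (k div m) / \<sigma>\<bar> = \<bar>\<sigma> * fst \<omega> k - w (k div m)\<bar>"
      proof -
        have "\<sigma> * fst \<omega> k - w (k div m) = \<sigma> * (fst \<omega> k - w (k div m) / \<sigma>)"
          using \<sigma> by (simp add: right_diff_distrib)
        then show ?thesis using \<sigma> by (simp add: abs_mult)
      qed
      finally show ?thesis using True by simp
    next
      case False
      have k: "fst \<omega> k \<in> I k" using \<omega>1 that by (rule PiE_mem[OF _ lessThan_iff[THEN iffD2]])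
      from False have "\<bar>fst \<omega> k\<bar> \<le> T" using k by (auto simp: I_def abs_le_iff)
      then show ?thesis using False \<sigma> by (simp add: abs_mult)
    qed
    then show ?thesis
      unfolding relu_net_refine[OF m, of N w b0 x] by (rule relu_net_diff_le[OF _ x b])
  qed
  show ?thesis using A mass close by (intro that[of A]) auto
qed

section \<open>Contraction for general scalings\<close>

lemma expected_posterior_mass_nonneg: "0 \<le> expected_posterior_mass \<rho> PX f0 prior n r"
  unfolding expected_posterior_mass_def rho_posterior_def set_lebesgue_integral_def
  by (intro Bochner_Integration.integral_nonneg divide_nonneg_nonneg) simp_all

text \<open>Fitting the offset to precision \<open>N powr - \<beta>\<close> thus costs only a
  multiple of \<open>N\<close> in log-probability, like the knots themselves.\<close>

lemma exp_neg_le_inverse_powr: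
  assumes "1 \<le> N" "\<beta> \<le> 2"
  shows "exp (- 2 * real N) \<le> real N powr - \<beta>"
proof -
  have "\<beta> * ln (real N) \<le> 2 * real N"
    using assms ln_le_minus_one[of "real N"] by (intro mult_mono) auto
  then show ?thesis using assms by (simp add: powr_def)
qed

text \<open>The left side is what matching all interpolant weights costs in log-probability, up to
  constants. The initial slope contributes an extra \<open>(1 / \<sigma>) powr p\<close>, which is
  compared with the sum over all knots.\<close>

lemma interp_weight_powr_le:
  assumes \<beta>: "0 < \<beta>" "\<beta> \<le> 2" and L: "0 < L" and f: "f \<in> holder_ball \<beta> L"
    and N: "0 < N" and \<sigma>: "0 < \<sigma>" and p: "0 < p" "p \<le> 1"
  shows "(\<Sum>j<N. \<bar>interp_weight f N j / \<sigma>\<bar> powr p)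
    \<le> (2 * L) powr p * (2 * (real N * (real N powr (1 - \<beta>) / \<sigma>) powr p))"
proof -
  define X where "X = real N powr (1 - \<beta>)"
  have X: "0 < X" using N by (simp add: X_def)
  have "\<bar>interp_weight f N j / \<sigma>\<bar> powr p
      \<le> (2 * L) powr p * ((if j = 0 then (1 / \<sigma>) powr p else 0) + (X / \<sigma>) powr p)" if j: "j < N" for j
  proof -
    have "\<bar>interp_weight f N j\<bar> \<le> 2 * L * (if j = 0 then max 1 X else X)"
    proof (cases "j = 0")
      case True
      have "L * max 1 X \<le> 2 * L * max 1 X" using L by (intro mult_right_mono) auto
      with holder_ball_piecewise_linear(2)[OF \<beta> L f N] True show ?thesis by (simp add: X_def)
    next
      case False
      with holder_ball_piecewise_linear(3)[OF \<beta> L f N, of j] j show ?thesis by (simp add: X_def)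
    qed
    then have "\<bar>interp_weight f N j / \<sigma>\<bar> \<le> 2 * L * ((if j = 0 then max 1 X else X) / \<sigma>)"
      using \<sigma> by (simp add: divide_right_mono)
    then have "\<bar>interp_weight f N j / \<sigma>\<bar> powr p \<le> (2 * L * ((if j = 0 then max 1 X else X) / \<sigma>)) powr p"
      using p by (intro powr_mono2) auto
    also have "\<dots> = (2 * L) powr p * ((if j = 0 then max 1 X else X) / \<sigma>) powr p"
      using L X \<sigma> by (intro powr_mult) 
    also have "((if j = 0 then max 1 X else X) / \<sigma>) powr p \<le> (if j = 0 then (1 / \<sigma>) powr p else 0) + (X / \<sigma>) powr p"
      by (simp add: max_def)
    finally show ?thesis using L by (simp add: mult_left_mono)
  qed
  then have "(\<Sum>j<N. \<bar>interp_weight f N j / \<sigma>\<bar> powr p)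
      \<le> (\<Sum>j<N. (2 * L) powr p * ((if j = 0 then (1 / \<sigma>) powr p else 0) + (X / \<sigma>) powr p))"
    by (intro sum_mono) auto
  also have "\<dots> = (2 * L) powr p * ((1 / \<sigma>) powr p + real N * (X / \<sigma>) powr p)"
    using N by (simp add: sum_distrib_left[symmetric] sum.distrib)
  \<comment> \<open>After cancelling \<sigma> the claim is that the exponent
    \<open>1 + (1 - \<beta>) * p\<close> is nonnegative: it is at least \<open>1 - p\<close> as
    \<beta> \<le> 2.\<close>
  also have "(1 / \<sigma>) powr p \<le> real N * (X / \<sigma>) powr p"
  proof -
    have "p * \<beta> \<le> p * 2" using p \<beta> by (intro mult_left_mono) auto
    moreover have "(1 - \<beta>) * p = p - p * \<beta>" by (simp add: algebra_simps)
    ultimately have "0 \<le> 1 + (1 - \<beta>) * p" using p by linarith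
    then have "1 \<le> real N powr (1 + (1 - \<beta>) * p)" using N by (intro ge_one_powr_ge_zero) auto
    then have "1 * (1 / \<sigma>) powr p \<le> real N powr (1 + (1 - \<beta>) * p) * (1 / \<sigma>) powr p"
      by (intro mult_right_mono) auto
    also have "\<dots> = real N * (X / \<sigma>) powr p"
      using N \<sigma> by (simp add: X_def powr_divide powr_powr powr_add)
    finally show ?thesis by simp
  qed
  finally show ?thesis using L by (simp add: X_def)
qed

text \<open>Bernoulli's inequality: at most 2n factors, each short of one by
  \<open>2 * d / n\<^sup>2\<close>, lose \<open>4 * d / n\<close> in total, and
  \<open>8 * d \<le> n\<close> makes this at most 1/2.\<close>

lemma power_one_minus_ge_half:
  assumes "0 < n" "0 \<le> d" "8 * d \<le> real n" "real N \<le> 2 * real n"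
  shows "1 / 2 \<le> (1 - 2 * d / (real n)\<^sup>2) ^ N" "0 \<le> 1 - 2 * d / (real n)\<^sup>2"
proof -
  have n: "1 \<le> real n" using assms(1) by simp
  have "2 * d \<le> real n" using assms by linarith
  also have "real n \<le> (real n)\<^sup>2" using n by (simp add: power2_eq_square)
  finally have *: "2 * d / (real n)\<^sup>2 \<le> 1" using n by (simp add: divide_le_eq)
  then show "0 \<le> 1 - 2 * d / (real n)\<^sup>2" by simp
  have "real N * (2 * d / (real n)\<^sup>2) \<le> 2 * real n * (2 * d / (real n)\<^sup>2)"
    using assms by (intro mult_right_mono) auto
  also have "\<dots> = 4 * d / real n" using n by (simp add: power2_eq_square)
  also have "\<dots> \<le> 1 / 2" using assms n by (simp add: divide_le_eq)
  finally show "1 / 2 \<le> (1 - 2 * d / (real n)\<^sup>2) ^ N"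
    using Bernoulli_inequality[of "- (2 * d / (real n)\<^sup>2)" N] * by simp
qed

context random_design
begin

text \<open>\<open>bias\<close> pays for interpolation and offset, \<open>noise\<close> for
  unmatched weights; \<open>dim\<close> and \<open>weights\<close> bound the log-probability of the
  match. \<open>rate\<close> makes the final exponential bound vanish polynomially in
  \<open>n\<close>.\<close>

lemma relu_posterior_contraction:
  fixes \<beta> L p q \<rho> K :: real and f0 h g :: "real \<Rightarrow> real" and Na Nb :: "nat \<Rightarrow> nat" and \<sigma> \<epsilon> :: "nat \<Rightarrow> real"
  assumes \<beta>: "0 < \<beta>" "\<beta> \<le> 2" and L: "0 < L" and f0: "f0 \<in> holder_ball \<beta> L"
    and p: "0 < p" "p \<le> 1" and h: "prob_density h" and tails: "exp_tails p q h"
    and g: "prob_density g" "continuous_on UNIV g" "\<And>t. 0 < g t"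
    and \<rho>: "0 < \<rho>" "\<rho> < 1" and K: "0 < K"
    and width: "\<forall>\<^sub>F n in sequentially. 0 < Nb n \<and> 0 < Na n \<and> Nb n dvd Na n \<and> real (Na n) \<le> 2 * real n"
    and pos: "\<forall>\<^sub>F n in sequentially. 0 < \<sigma> n \<and> 0 < \<epsilon> n"
    and bias: "\<forall>\<^sub>F n in sequentially. real (Nb n) powr - \<beta> \<le> K * \<epsilon> n"
    and noise: "\<forall>\<^sub>F n in sequentially. real (Na n) * \<sigma> n * ln (real n) powr (1 / q) \<le> K * \<epsilon> n"
    and dim: "\<forall>\<^sub>F n in sequentially. real (Nb n) \<le> K * (real n * (\<epsilon> n)\<^sup>2)"
    and weights: "\<forall>\<^sub>F n in sequentially.
      real (Nb n) * (real (Nb n) powr (1 - \<beta>) / \<sigma> n) powr p \<le> K * (real n * (\<epsilon> n)\<^sup>2)"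
    and rate: "\<forall>\<^sub>F n in sequentially. ln (real n) \<le> K * (real n * (\<epsilon> n)\<^sup>2)"
  shows "\<exists>M>0. (\<lambda>n. expected_posterior_mass \<rho> PX f0 (relu_prior (Na n) (\<sigma> n) h g) n (M * (\<epsilon> n)\<^sup>2)) \<longlonglongrightarrow> 0"
proof -
  have q: "0 < q" using tails by (simp add: exp_tails_def)
  have f0_meas: "f0 \<in> borel_measurable PX"
    using holder_ball_continuous[OF \<beta> _ f0] L by (intro continuous_on_measurable_PX) auto
  obtain d0 d1 M0 where d: "0 < d0" "0 < d1" "0 < M0"
    and central: "\<forall>x\<ge>M0. 1 - 2 * d0 * exp (- d1 * x powr q) \<le> measure (density lborel (\<lambda>t. ennreal (h t))) {- x..x}"
    using exp_tails_central_mass[OF h tails] by blast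
  obtain c0 c1 where c: "0 < c0" "0 < c1"
    and unit: "\<forall>t. c0 * exp (- c1 * (1 + \<bar>t\<bar> powr p)) \<le> measure (density lborel (\<lambda>t. ennreal (h t))) {t - 1..t + 1}"
    using exp_tails_unit_ball_mass[OF h tails p] by blast
  obtain cb where cb: "0 < cb"
    and offset: "\<forall>\<delta>\<in>{0..1}. cb * \<delta> \<le> measure (density lborel (\<lambda>t. ennreal (g t))) {f0 0 - \<delta>..f0 0 + \<delta>}"
    using positive_density_ball_mass[OF g] by blast
  \<comment> \<open>The summand 2 pays for the offset precision, \<open>ln 2\<close> for the
    threshold event of probability at least 1/2, and \<open>\<bar>ln cb\<bar>\<close> for the offset
    density. \<open>C2\<close> adds the approximation errors, and \<open>M\<close> solves
    \<open>(1 - \<rho>) * M = C1 + \<rho> * C2\<^sup>2 + 1\<close>, leaving the exponent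
    \<open>- R / 2\<close>.\<close>
  define C1 where "C1 = ((\<bar>ln c0\<bar> + c1 + 2) + c1 * ((2 * L) powr p * 2) + (ln 2 + \<bar>ln cb\<bar>)) * K"
  define C2 where "C2 = (2 * L + 1) * K + (2 / d1) powr (1 / q) * K"
  define M where "M = (C1 + \<rho> * C2\<^sup>2 + 1) / (1 - \<rho>)"
  have C1: "0 \<le> C1" unfolding C1_def using c K by (intro mult_nonneg_nonneg add_nonneg_nonneg) auto
  have M: "0 < M" unfolding M_def using C1 \<rho> by (intro divide_pos_pos add_nonneg_pos add_nonneg_nonneg) auto
  have large_n: "\<forall>\<^sub>F n in sequentially. 0 < n \<and> 8 * d0 \<le> real n \<and> d1 / 2 * max 1 M0 powr q \<le> ln (real n)"
    by (intro eventually_conj eventually_gt_at_top filterlim_real_sequentially[THEN filterlim_at_top[THEN iffD1, rule_format]]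
        filterlim_compose[OF ln_at_top filterlim_real_sequentially, THEN filterlim_at_top[THEN iffD1, rule_format]])
  have bound: "\<forall>\<^sub>F n in sequentially.
      expected_posterior_mass \<rho> PX f0 (relu_prior (Na n) (\<sigma> n) h g) n (M * (\<epsilon> n)\<^sup>2) \<le> exp (- (1 / (2 * K)) * ln (real n))"
    using width pos bias noise dim weights rate large_n
  proof eventually_elim
    case (elim n)
    define R where "R = real n * (\<epsilon> n)\<^sup>2"
    define N where "N = Nb n"
    define s where "s = \<sigma> n"
    obtain m where m: "Na n = m * N" using elim(1) by (auto simp: N_def dvd_def mult.commute)
    have N: "0 < N" and m0: "0 < m" using elim(1) m by (auto simp: N_def)
    have s: "0 < s" and \<epsilon>: "0 < \<epsilon> n" and n: "0 < n" using elim by (auto simp: s_def)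
    define w where "w = interp_weight f0 N"
    \<comment> \<open>Chosen so that the tail bound \<open>exp (- d1 * T powr q)\<close> is exactly
      \<open>1 / n\<^sup>2\<close>.\<close>
    define T where "T = (2 / d1 * ln (real n)) powr (1 / q)"
    define \<delta> where "\<delta> = real N powr - \<beta>"
    define a where "a = (\<lambda>j. c0 * exp (- c1 * (1 + \<bar>w j / s\<bar> powr p)))"
    define \<tau> where "\<tau> = 1 - 2 * d0 / (real n)\<^sup>2"
    have ln_n: "0 \<le> ln (real n)" using n by simp
    have T: "max 1 M0 \<le> T"
    proof -
      have "max 1 M0 = (max 1 M0 powr q) powr (1 / q)" using q by (simp add: powr_powr)
      also have "\<dots> \<le> T"
        unfolding T_def using elim(8) d q by (intro powr_mono2) (auto simp: field_simps)
      finally show ?thesis .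
    qed
    have "exp (- d1 * T powr q) = 1 / (real n)\<^sup>2"
    proof -
      have "T powr q = 2 / d1 * ln (real n)"
        unfolding T_def using q d ln_n by (simp add: powr_powr)
      then have "exp (- d1 * T powr q) = exp (- (2 * ln (real n)))" using d by simp
      also have "\<dots> = 1 / (real n)\<^sup>2"
        using n by (simp add: exp_minus inverse_eq_divide exp_of_nat_mult[of 2, simplified])
      finally show ?thesis .
    qed
    then have \<tau>_le: "\<tau> \<le> measure (density lborel (\<lambda>t. ennreal (h t))) {- T..T}"
      using central[rule_format, of T] T by (simp add: \<tau>_def)
    have \<tau>: "1 / 2 \<le> \<tau> ^ (m * N)" "0 \<le> \<tau>"
      unfolding \<tau>_def using power_one_minus_ge_half[of n d0 "m * N"] elim(1,8) d n m by auto
    have \<delta>: "0 < \<delta>" "\<delta> \<le> 1" 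
      unfolding \<delta>_def using N \<beta> powr_mono[of "- \<beta>" 0 "real N"] by auto
    have a: "0 \<le> a j" "a j \<le> measure (density lborel (\<lambda>t. ennreal (h t))) {w j / s - 1..w j / s + 1}" for j
      unfolding a_def using c unit[rule_format, of "w j / s"] by (simp, blast)
    have \<gamma>: "0 \<le> cb * \<delta>" "cb * \<delta> \<le> measure (density lborel (\<lambda>t. ennreal (g t))) {f0 0 - \<delta>..f0 0 + \<delta>}"
      using cb \<delta> offset by auto
    have T1: "1 \<le> T" using T by simp
    obtain A where A: "A \<in> sets (relu_param (m * N) h g)"
      and mass: "(\<Prod>j<N. a j) * \<tau> ^ (m * N) * (cb * \<delta>) \<le> measure (relu_param (m * N) h g) A"
      and close: "\<forall>\<omega>\<in>A. \<forall>x\<in>{0..1}.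
        \<bar>relu_net (m * N) (\<lambda>k. s * fst \<omega> k) (snd \<omega>) x - relu_net N w (f0 0) x\<bar> \<le> real (m * N) * (s * T) + \<delta>"
      using relu_param_small_ball[OF h g(1) m0 s T1 a(1) a(2) \<tau>(2) \<tau>_le \<gamma>] .
    have close': "\<bar>relu_net (m * N) (\<lambda>k. s * fst \<omega> k) (snd \<omega>) x - f0 x\<bar> \<le> C2 * \<epsilon> n"
      if "\<omega> \<in> A" "x \<in> {0..1}" for \<omega> x
    proof -
      have "real (m * N) * (s * T) = (2 / d1) powr (1 / q) * (real (Na n) * \<sigma> n * ln (real n) powr (1 / q))"
        unfolding T_def s_def m powr_mult by (simp add: mult_ac)
      also have "\<dots> \<le> (2 / d1) powr (1 / q) * (K * \<epsilon> n)"
        using elim(4) by (intro mult_left_mono) auto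
      finally have 1: "real (m * N) * (s * T) \<le> (2 / d1) powr (1 / q) * (K * \<epsilon> n)" .
      have "(2 * L + 1) * \<delta> \<le> (2 * L + 1) * (K * \<epsilon> n)"
        using elim(3) L unfolding \<delta>_def N_def by (intro mult_left_mono) auto
      moreover have "\<bar>relu_net N w (f0 0) x - f0 x\<bar> \<le> 2 * L * \<delta>"
        using holder_ball_piecewise_linear(1)[OF \<beta> L f0 N that(2)] by (simp add: w_def \<delta>_def)
      ultimately show ?thesis
        using close[rule_format, OF that] 1 unfolding C2_def by (simp add: algebra_simps)
    qed
    have mass': "exp (- (C1 * R)) \<le> measure (relu_param (m * N) h g) A"
    proof -
      define S where "S = (\<Sum>j<N. \<bar>w j / s\<bar> powr p)"
      have NR: "real N \<le> K * R" using elim(5) by (simp add: N_def R_def)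
      have "1 \<le> real N" using N by simp
      \<comment> \<open>Lets the costs that do not grow with \<open>N\<close> be charged to
        \<open>K * R\<close> as well.\<close>
      then have KR: "1 \<le> K * R" using NR by linarith
      have S: "S \<le> (2 * L) powr p * (2 * (K * R))"
      proof -
        have "S \<le> (2 * L) powr p * (2 * (real N * (real N powr (1 - \<beta>) / s) powr p))"
          unfolding S_def w_def by (rule interp_weight_powr_le[OF \<beta> L f0 N s p])
        also have "\<dots> \<le> (2 * L) powr p * (2 * (K * R))"
          using elim(6) by (intro mult_left_mono) (auto simp: N_def s_def R_def)
        finally show ?thesis .
      qed
      have prod: "(\<Prod>j<N. a j) = exp (real N * ln c0 - c1 * (real N + S))"
      proof -
        have "a j = exp (ln c0 - c1 * (1 + \<bar>w j / s\<bar> powr p))" for j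
          using c by (simp add: a_def exp_diff exp_minus divide_inverse)
        then have "(\<Prod>j<N. a j) = exp (\<Sum>j<N. ln c0 - c1 * (1 + \<bar>w j / s\<bar> powr p))"
          by (simp add: exp_sum)
        also have "(\<Sum>j<N. ln c0 - c1 * (1 + \<bar>w j / s\<bar> powr p)) = real N * ln c0 - c1 * (real N + S)"
          by (simp add: sum_subtractf S_def sum.distrib flip: sum_distrib_left)
        finally show ?thesis .
      qed
      have "(\<bar>ln c0\<bar> + c1 + 2) * real N + c1 * S + (ln 2 + \<bar>ln cb\<bar>) * 1
          \<le> (\<bar>ln c0\<bar> + c1 + 2) * (K * R) + c1 * ((2 * L) powr p * (2 * (K * R))) + (ln 2 + \<bar>ln cb\<bar>) * (K * R)"
        using NR S KR c by (intro add_mono mult_left_mono) auto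
      also have "\<dots> = C1 * R" by (simp add: C1_def algebra_simps)
      finally have "(\<bar>ln c0\<bar> + c1 + 2) * real N + c1 * S + (ln 2 + \<bar>ln cb\<bar>) \<le> C1 * R" by simp
      moreover have "- \<bar>ln c0\<bar> * real N \<le> real N * ln c0"
        using mult_right_mono[of "- \<bar>ln c0\<bar>" "ln c0" "real N"] by (simp add: mult.commute)
      ultimately have "- (C1 * R) \<le> real N * ln c0 - c1 * (real N + S) - ln 2 + ln cb - 2 * real N"
        by (simp add: algebra_simps)
      then have "exp (- (C1 * R)) \<le> exp (real N * ln c0 - c1 * (real N + S) - ln 2 + ln cb - 2 * real N)"
        by simp
      also have "\<dots> = (\<Prod>j<N. a j) * (1 / 2) * (cb * exp (- 2 * real N))"
      proof -
        have "exp (x - ln 2 + ln cb - 2 * real N) = exp x * (1 / 2) * (cb * exp (- 2 * real N))" for x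
          using cb by (simp add: exp_diff exp_add exp_minus field_simps)
        then show ?thesis unfolding prod .
      qed
      also have "\<dots> \<le> (\<Prod>j<N. a j) * \<tau> ^ (m * N) * (cb * \<delta>)"
        using \<tau> cb exp_neg_le_inverse_powr[of N \<beta>] N \<beta> unfolding prod \<delta>_def by (intro mult_mono) auto
      also note mass
      finally show ?thesis .
    qed
    have "expected_posterior_mass \<rho> PX f0 (relu_prior (m * N) s h g) n (M * (\<epsilon> n)\<^sup>2)
        \<le> exp ((C1 * R + real n * \<rho> * (C2 * \<epsilon> n)\<^sup>2 - (1 - \<rho>) * real n * (M * (\<epsilon> n)\<^sup>2)) / 2)"
      unfolding relu_prior_eq
    proof (rule expected_posterior_mass_le[OF prob_space_relu_param[OF h g(1)] _ relu_net_measurable_cont_space f0_meas \<rho> A close' mass' n])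
      show "(\<lambda>p. relu_net (m * N) (\<lambda>k. s * fst (fst p) k) (snd (fst p)) (snd p)) \<in> borel_measurable (relu_param (m * N) h g \<Otimes>\<^sub>M PX)"
        using continuous_on_measurable_PX[of "\<lambda>x. x"] by (intro relu_net_measurable_pair) auto
    qed
    also have "(C1 * R + real n * \<rho> * (C2 * \<epsilon> n)\<^sup>2 - (1 - \<rho>) * real n * (M * (\<epsilon> n)\<^sup>2)) / 2 = - R / 2"
    proof -
      have "(1 - \<rho>) * M = C1 + \<rho> * C2\<^sup>2 + 1" using \<rho> by (simp add: M_def)
      moreover have "(1 - \<rho>) * real n * (M * (\<epsilon> n)\<^sup>2) = (1 - \<rho>) * M * R"
        by (simp add: R_def)
      ultimately have "(1 - \<rho>) * real n * (M * (\<epsilon> n)\<^sup>2) = (C1 + \<rho> * C2\<^sup>2 + 1) * R"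
        by simp
      then show ?thesis by (simp add: R_def power_mult_distrib algebra_simps)
    qed
    also have "exp (- R / 2) \<le> exp (- (1 / (2 * K)) * ln (real n))"
      using elim(7) K by (simp add: R_def field_simps)
    finally show ?case by (simp add: m s_def)
  qed
  have "(\<lambda>n. exp (- (1 / (2 * K)) * ln (real n))) \<longlonglongrightarrow> 0"
  proof (rule filterlim_compose[OF exp_at_bot])
    have "filterlim (\<lambda>n. 1 / (2 * K) * ln (real n)) at_top sequentially"
      using K by (intro filterlim_tendsto_pos_mult_at_top[OF tendsto_const _ filterlim_compose[OF ln_at_top filterlim_real_sequentially]]) auto
    then show "filterlim (\<lambda>n. - (1 / (2 * K)) * ln (real n)) at_bot sequentially"
      by (simp add: filterlim_uminus_at_bot)
  qed
  then have "(\<lambda>n. expected_posterior_mass \<rho> PX f0 (relu_prior (Na n) (\<sigma> n) h g) n (M * (\<epsilon> n)\<^sup>2)) \<longlonglongrightarrow> 0"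
    by (intro tendsto_sandwich[OF _ bound tendsto_const]) (simp_all add: expected_posterior_mass_nonneg)
  then show ?thesis using M by blast
qed

end

section \<open>The two scalings\<close>

lemma width_pos: "0 < width s n"
  by (simp add: width_def)

text \<open>Both widths are powers of two, and rounding is monotone in the exponent.\<close>

lemma width_dvd_width:
  assumes "0 \<le> \<alpha>" "\<alpha> \<le> \<beta>" "0 < n"
  shows "width \<beta> n dvd width \<alpha> n"
proof -
  have "log 2 (real n) / (2 * \<beta> + 1) \<le> log 2 (real n) / (2 * \<alpha> + 1)"
    using assms by (intro divide_left_mono) auto
  then show ?thesis
    unfolding width_def by (intro le_imp_power_dvd nat_mono round_mono)
qed

lemma width_bounds:
  assumes "0 \<le> s" "0 < n"
  shows "real (width s n) \<le> 2 * real n powr (1 / (2 * s + 1))"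
    and "real n powr (1 / (2 * s + 1)) \<le> 2 * real (width s n)"
proof -
  define x where "x = log 2 (real n) / (2 * s + 1)"
  have x: "0 \<le> x" using assms by (simp add: x_def)
  have pw: "2 powr x = real n powr (1 / (2 * s + 1))"
    using assms by (simp add: x_def powr_def log_def)
  \<comment> \<open>So \<open>nat\<close> in the definition of \<open>width\<close> truncates
    nothing; rounding then changes the power by a factor of at most 2.\<close>
  have "0 \<le> round x" using x round_mono[of 0 x] by simp
  then have w: "real (width s n) = 2 powr (real_of_int (round x))"
    by (simp add: width_def x_def[symmetric] powr_realpow[symmetric])
  have r: "real_of_int (round x) \<le> 1 + x" "x \<le> 1 + real_of_int (round x)"
    using of_int_round_le[of x] of_int_round_ge[of x] by linarith+
  have "2 powr (real_of_int (round x)) \<le> 2 powr (1 + x)" using r(1) by (intro powr_mono) auto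
  then show "real (width s n) \<le> 2 * real n powr (1 / (2 * s + 1))"
    by (simp add: w powr_add pw)
  have "2 powr x \<le> 2 powr (1 + real_of_int (round x))" using r(2) by (intro powr_mono) auto
  then show "real n powr (1 / (2 * s + 1)) \<le> 2 * real (width s n)"
    by (simp add: w powr_add pw)
qed

context
  fixes \<beta> :: real and n :: nat
  assumes \<beta>: "0 < \<beta>" "\<beta> \<le> 2" and n: "0 < n"
begin

text \<open>The minimax balance: \<open>n\<close> times the squared rate has the order of the number
  of coarse knots.\<close>

lemma minimax_rate_sq: "real n * (real n powr (- \<beta> / (1 + 2 * \<beta>)))\<^sup>2 = real n powr (1 / (2 * \<beta> + 1))"
proof -
  have "real n * (real n powr (- \<beta> / (1 + 2 * \<beta>)))\<^sup>2 = real n powr (1 + (- \<beta> / (1 + 2 * \<beta>) + - \<beta> / (1 + 2 * \<beta>)))"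
    by (simp only: power2_eq_square powr_add powr_one of_nat_0_le_iff)
  also have "1 + (- \<beta> / (1 + 2 * \<beta>) + - \<beta> / (1 + 2 * \<beta>)) = 1 / (2 * \<beta> + 1)"
  proof -
    have *: "1 / (1 + 2 * \<beta>) + 2 * \<beta> / (1 + 2 * \<beta>) = 1"
      unfolding add_divide_distrib[symmetric] using \<beta> by simp
    show ?thesis unfolding add.commute[of "2 * \<beta>" 1] using * by simp
  qed
  finally show ?thesis .
qed

text \<open>The sign of \<open>c\<close> decides which of the two width bounds applies; the constant
  is 2 squared.\<close>

lemma width_powr_le:
  assumes "- 2 \<le> c" "c \<le> 2"
  shows "real (width \<beta> n) powr c \<le> 4 * real n powr (c / (2 * \<beta> + 1))"
proof -
  define y where "y = real n powr (1 / (2 * \<beta> + 1))"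
  have y: "0 < y" using n by (simp add: y_def)
  have N: "0 < real (width \<beta> n)" by (simp add: width_pos)
  have yc: "y powr c = real n powr (c / (2 * \<beta> + 1))" by (simp add: y_def powr_powr)
  have four: "2 powr c \<le> 4" "2 powr - c \<le> 4"
    using powr_mono[of c 2 "2 :: real"] powr_mono[of "- c" 2 "2 :: real"] assms by auto
  have bounds: "real (width \<beta> n) \<le> 2 * y" "y \<le> 2 * real (width \<beta> n)"
    using width_bounds[of \<beta> n] \<beta> n by (auto simp: y_def)
  have "real (width \<beta> n) powr c \<le> 4 * y powr c"
  proof (cases "0 \<le> c")
    case True
    then have "real (width \<beta> n) powr c \<le> (2 * y) powr c" using bounds by (intro powr_mono2) auto
    also have "\<dots> \<le> 4 * y powr c" unfolding powr_mult using four by (intro mult_right_mono) auto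
    finally show ?thesis .
  next
    case False
    then have "real (width \<beta> n) powr c \<le> (y / 2) powr c" using bounds y by (intro powr_mono2') auto
    also have "\<dots> = 2 powr - c * y powr c" using y by (simp add: powr_divide powr_minus_divide)
    also have "\<dots> \<le> 4 * y powr c" using four by (intro mult_right_mono) auto
    finally show ?thesis .
  qed
  then show ?thesis by (simp add: yc)
qed

end

lemma ln_le_powr_rate:
  assumes "0 < \<beta>" "\<beta> \<le> 2" "0 < n"
  shows "ln (real n) \<le> 5 * real n powr (1 / (2 * \<beta> + 1))"
proof -
  have "ln (real n) \<le> real n powr (1 / (2 * \<beta> + 1)) / (1 / (2 * \<beta> + 1))"
    using assms by (intro ln_powr_bound) auto
  also have "\<dots> = (2 * \<beta> + 1) * real n powr (1 / (2 * \<beta> + 1))" using assms by simp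
  also have "\<dots> \<le> 5 * real n powr (1 / (2 * \<beta> + 1))" using assms by (intro mult_right_mono) auto
  finally show ?thesis .
qed

context random_design
begin

text \<open>\<kappa> is the loss over the minimax rate. Once it is at least one, the conditions on
  bias, dimension and logarithm follow from the size of the coarse width. The constant 32 combines
  the factor 2 of the width with the 16 in \<open>weights\<close>.\<close>

lemma relu_posterior_contraction_width:
  fixes \<alpha> \<beta> L p q \<rho> :: real and f0 h g :: "real \<Rightarrow> real" and \<sigma> \<kappa> :: "nat \<Rightarrow> real"
  assumes \<beta>: "0 < \<beta>" "\<beta> \<le> 2" and L: "0 < L" and f0: "f0 \<in> holder_ball \<beta> L" and \<alpha>: "0 \<le> \<alpha>" "\<alpha> \<le> \<beta>"
    and p: "0 < p" "p \<le> 1" and h: "prob_density h" and tails: "exp_tails p q h"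
    and g: "prob_density g" "continuous_on UNIV g" "\<And>t. 0 < g t" and \<rho>: "0 < \<rho>" "\<rho> < 1"
    and pos: "\<forall>\<^sub>F n in sequentially. 0 < \<sigma> n \<and> 1 \<le> \<kappa> n"
    and noise: "\<forall>\<^sub>F n in sequentially. real (width \<alpha> n) * \<sigma> n * ln (real n) powr (1 / q)
      \<le> 32 * (real n powr (- \<beta> / (1 + 2 * \<beta>)) * \<kappa> n)"
    and weights: "\<forall>\<^sub>F n in sequentially. (real (width \<beta> n) powr (1 - \<beta>) / \<sigma> n) powr p \<le> 16 * (\<kappa> n)\<^sup>2"
  shows "\<exists>M>0. (\<lambda>n. expected_posterior_mass \<rho> PX f0 (relu_prior (width \<alpha> n) (\<sigma> n) h g) n
    (M * (real n powr (- \<beta> / (1 + 2 * \<beta>)) * \<kappa> n)\<^sup>2)) \<longlonglongrightarrow> 0"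
proof (rule relu_posterior_contraction[OF \<beta> L f0 p h tails g \<rho>, where K = 32 and Nb = "width \<beta>"])
  define y where "y = (\<lambda>n. real n powr (1 / (2 * \<beta> + 1)))"
  have sq: "real n * (real n powr (- \<beta> / (1 + 2 * \<beta>)) * \<kappa> n)\<^sup>2 = y n * (\<kappa> n)\<^sup>2" if "0 < n" for n
    using minimax_rate_sq[OF \<beta> that] by (simp add: power_mult_distrib y_def flip: mult.assoc)
  have base: "\<forall>\<^sub>F n in sequentially. 0 < n \<and> 0 < \<sigma> n \<and> 1 \<le> \<kappa> n"
    using pos eventually_gt_at_top[of 0] by eventually_elim auto
  have grow: "y n \<le> y n * (\<kappa> n)\<^sup>2" if "1 \<le> \<kappa> n" for n
    using that mult_left_mono[of 1 "(\<kappa> n)\<^sup>2" "y n"] by (simp add: y_def)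
  have y0: "0 \<le> y n" for n by (simp add: y_def)
  have wy: "real (width \<beta> n) \<le> 2 * y n" if "0 < n" for n
    using width_bounds[of \<beta> n] \<beta> that by (simp add: y_def)
  show "(0 :: real) < 32" by simp
  show "\<forall>\<^sub>F n in sequentially. 0 < width \<beta> n \<and> 0 < width \<alpha> n \<and> width \<beta> n dvd width \<alpha> n
      \<and> real (width \<alpha> n) \<le> 2 * real n"
    using base
  proof eventually_elim
    case (elim n)
    have "real (width \<alpha> n) \<le> 2 * real n powr (1 / (2 * \<alpha> + 1))"
      using width_bounds[of \<alpha> n] \<alpha> elim by simp
    also have "\<dots> \<le> 2 * real n powr 1"
      using elim \<alpha> by (intro mult_left_mono powr_mono) auto
    finally show ?case using elim width_dvd_width[OF \<alpha>, of n] by (simp add: width_pos)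
  qed
  show "\<forall>\<^sub>F n in sequentially. 0 < \<sigma> n \<and> 0 < real n powr (- \<beta> / (1 + 2 * \<beta>)) * \<kappa> n"
    using base by eventually_elim auto
  show "\<forall>\<^sub>F n in sequentially. real (width \<beta> n) powr - \<beta> \<le> 32 * (real n powr (- \<beta> / (1 + 2 * \<beta>)) * \<kappa> n)"
    using base
  proof eventually_elim
    case (elim n)
    have "real (width \<beta> n) powr - \<beta> \<le> 4 * real n powr (- \<beta> / (1 + 2 * \<beta>))"
      using width_powr_le[OF \<beta>, of n "- \<beta>"] elim \<beta> by (simp add: add.commute)
    also have "\<dots> \<le> 32 * (real n powr (- \<beta> / (1 + 2 * \<beta>)) * \<kappa> n)"
      using elim mult_left_mono[of 1 "\<kappa> n" "real n powr (- \<beta> / (1 + 2 * \<beta>))"] by simp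
    finally show ?case .
  qed
  show "\<forall>\<^sub>F n in sequentially. real (width \<beta> n) \<le> 32 * (real n * (real n powr (- \<beta> / (1 + 2 * \<beta>)) * \<kappa> n)\<^sup>2)"
    using base
  proof eventually_elim
    case (elim n)
    then have n: "0 < n" by simp
    show ?case unfolding sq[OF n] using elim wy[of n] grow[of n] y0[of n] by linarith
  qed
  show "\<forall>\<^sub>F n in sequentially. ln (real n) \<le> 32 * (real n * (real n powr (- \<beta> / (1 + 2 * \<beta>)) * \<kappa> n)\<^sup>2)"
    using base
  proof eventually_elim
    case (elim n)
    then have n: "0 < n" by simp
    then have "ln (real n) \<le> 5 * y n" using ln_le_powr_rate[OF \<beta>, of n] by (simp add: y_def)
    then show ?case unfolding sq[OF n] using elim grow[of n] y0[of n] by linarith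
  qed
  show "\<forall>\<^sub>F n in sequentially. real (width \<beta> n) * (real (width \<beta> n) powr (1 - \<beta>) / \<sigma> n) powr p
      \<le> 32 * (real n * (real n powr (- \<beta> / (1 + 2 * \<beta>)) * \<kappa> n)\<^sup>2)"
    using base weights
  proof eventually_elim
    case (elim n)
    have "real (width \<beta> n) * (real (width \<beta> n) powr (1 - \<beta>) / \<sigma> n) powr p \<le> (2 * y n) * (16 * (\<kappa> n)\<^sup>2)"
      using elim wy[of n] y0[of n] by (intro mult_mono) auto
    also have "\<dots> = 32 * (y n * (\<kappa> n)\<^sup>2)" by simp
    also have "\<dots> = 32 * (real n * (real n powr (- \<beta> / (1 + 2 * \<beta>)) * \<kappa> n)\<^sup>2)"
      using elim by (subst sq) simp_all
    finally show ?case .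
  qed
qed (rule noise)

end

text \<open>Here \<open>a\<close>, \<open>b\<close>, \<open>l\<close> stand for the two widths and
  the logarithm. Eliminating \<kappa> from the two conclusions gives an equation for
  \<open>\<sigma> powr (2 + p)\<close>, whose solution is the stated scaling.\<close>

lemma tuned_scaling_identities:
  fixes a b l p q \<beta> :: real
  assumes pos: "0 < a" "0 < b" "0 < l" and p: "0 < p" and q: "0 < q"
  defines "\<sigma> \<equiv> a powr (- 2 / (2 + p)) * b powr (p / (2 + p) - \<beta>) * l powr (- 2 / (q * (2 + p)))"
    and "\<kappa> \<equiv> (a * b) powr (p / (2 + p)) * l powr (p / (q * (2 + p)))"
  shows "a * \<sigma> * l powr (1 / q) = b powr - \<beta> * \<kappa>"
    and "(b powr (1 - \<beta>) / \<sigma>) powr p = \<kappa>\<^sup>2"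
proof -
  have exp1: "p / (2 + p) = 1 - 2 / (2 + p)"
    using p by (simp add: field_simps)
  have "p / (q * (2 + p)) = p / (2 + p) / q" by (simp add: mult.commute)
  also have "\<dots> = 1 / q - 2 / (q * (2 + p))"
    unfolding exp1 diff_divide_distrib by (simp add: mult.commute)
  finally have exp2: "p / (q * (2 + p)) = 1 / q - 2 / (q * (2 + p))" .
  \<comment> \<open>All exponents are affine in \<open>u\<close> and \<open>v\<close>; with powers
    written as exponentials of logarithms, the identities become linear algebra.\<close>
  define u where "u = 2 / (2 + p)"
  define v where "v = 2 / (q * (2 + p))"
  have exps: "p / (2 + p) = 1 - u" "p / (q * (2 + p)) = 1 / q - v" "- 2 / (2 + p) = - u" "- 2 / (q * (2 + p)) = - v"
    unfolding exp1 exp2 by (simp_all add: u_def v_def)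
  have pows: "a = exp (ln a)" "a powr c = exp (c * ln a)" "b powr c = exp (c * ln b)" "l powr c = exp (c * ln l)"
    "(a * b) powr c = exp (c * (ln a + ln b))" for c
    using pos by (simp_all add: powr_def ln_mult)
  have \<sigma>: "\<sigma> = exp (- 2 / (2 + p) * ln a + (p / (2 + p) - \<beta>) * ln b + - 2 / (q * (2 + p)) * ln l)"
    unfolding \<sigma>_def pows(2-4) by (simp only: exp_add)
  have \<kappa>: "\<kappa> = exp (p / (2 + p) * (ln a + ln b) + p / (q * (2 + p)) * ln l)"
    unfolding \<kappa>_def pows(4,5) by (simp only: exp_add)
  have "a * \<sigma> * l powr (1 / q) = exp (ln a + (- 2 / (2 + p) * ln a + (p / (2 + p) - \<beta>) * ln b + - 2 / (q * (2 + p)) * ln l) + 1 / q * ln l)"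
    unfolding \<sigma> pows(4) using pos by (simp only: exp_add exp_ln)
  also have "\<dots> = exp (- \<beta> * ln b + (p / (2 + p) * (ln a + ln b) + p / (q * (2 + p)) * ln l))"
    unfolding exps by (simp add: algebra_simps)
  also have "\<dots> = b powr - \<beta> * \<kappa>"
    unfolding \<kappa> pows(3) by (simp only: exp_add)
  finally show "a * \<sigma> * l powr (1 / q) = b powr - \<beta> * \<kappa>" .
  have "b powr (1 - \<beta>) / \<sigma>
      = exp ((1 - \<beta>) * ln b - (- 2 / (2 + p) * ln a + (p / (2 + p) - \<beta>) * ln b + - 2 / (q * (2 + p)) * ln l))"
    unfolding \<sigma> pows(3) by (simp only: exp_diff)
  also have "\<dots> = exp (u * (ln a + ln b) + v * ln l)"
    unfolding exps by (simp add: algebra_simps)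
  finally have "(b powr (1 - \<beta>) / \<sigma>) powr p = exp (p * (u * (ln a + ln b) + v * ln l))"
    by (simp only: powr_def exp_not_eq_zero if_False ln_exp)
  also have "p * (u * x + v * z) = 2 * (p / (2 + p) * x + p / (q * (2 + p)) * z)" for x z
    by (simp add: u_def v_def distrib_left mult_ac)
  also have "exp (2 * (p / (2 + p) * (ln a + ln b) + p / (q * (2 + p)) * ln l)) = \<kappa>\<^sup>2"
    unfolding \<kappa> by (simp only: exp_double)
  finally show "(b powr (1 - \<beta>) / \<sigma>) powr p = \<kappa>\<^sup>2" .
qed

theorem theorem4:
  fixes \<alpha> \<beta> L p q \<rho> :: real
    and f0 h g :: "real \<Rightarrow> real"
    and PX :: "real measure"
  assumes "0 < \<beta>" "\<beta> \<le> 2" "0 < L" "f0 \<in> holder_ball \<beta> L"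
    and "prob_space PX" "sets PX = sets (restrict_space borel {0..1})"
    and "0 \<le> \<alpha>" "\<alpha> \<le> \<beta>"
    and "0 < p" "p \<le> 1" "prob_density h" "exp_tails p q h"
    and "prob_density g" "\<And>t. g (- t) = g t" "continuous_on UNIV g" "\<And>t. 0 < g t"
    and "0 < \<rho>" "\<rho> < 1"
  defines "\<epsilon>_star \<equiv> \<lambda>n. real n powr (- \<beta> / (1 + 2 * \<beta>))"
    and "\<epsilon>_plus \<equiv> \<lambda>n. real n powr (- 2 / 5)"
    and "N\<alpha> \<equiv> \<lambda>n. width \<alpha> n"
    and "N\<beta> \<equiv> \<lambda>n. width \<beta> n"
  defines "\<sigma>_oracle \<equiv> \<lambda>n. real (N\<alpha> n) powr (- 2 / (2 + p))
              * real (N\<beta> n) powr (p / (2 + p) - \<beta>)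
              * ln (real n) powr (- 2 / (q * (2 + p)))"
    and "\<epsilon>_oracle \<equiv> \<lambda>n. \<epsilon>_star n * (real (N\<alpha> n) * real (N\<beta> n)) powr (p / (2 + p))
              * ln (real n) powr (p / (q * (2 + p)))"
    and "\<sigma>_nonoracle \<equiv> \<lambda>n. \<epsilon>_plus n / real (N\<alpha> n)"
    and "\<epsilon>_nonoracle \<equiv> \<lambda>n. \<epsilon>_star n
              * real n powr (p * ((1 - \<beta>) / (2 + 4 * \<beta>) + 1 / 5 + 1 / (2 + 4 * \<alpha>)))"
  shows
    "(\<exists>M>0. (\<lambda>n. expected_posterior_mass \<rho> PX f0 (relu_prior (N\<alpha> n) (\<sigma>_oracle n) h g) n
                   (M * (\<epsilon>_oracle n)\<^sup>2)) \<longlonglongrightarrow> 0) \<and>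
     (\<exists>M>0. (\<lambda>n. expected_posterior_mass \<rho> PX f0 (relu_prior (N\<alpha> n) (\<sigma>_nonoracle n) h g) n
                   (M * (\<epsilon>_nonoracle n)\<^sup>2)) \<longlonglongrightarrow> 0)"
proof -
  interpret random_design PX
    using assms(5,6) by (simp add: random_design_def random_design_axioms_def)
  have q: "0 < q" using \<open>exp_tails p q h\<close> by (simp add: exp_tails_def)
  note \<beta> = assms(1,2) and \<alpha> = assms(7,8) and p = assms(9,10)
  note contraction = relu_posterior_contraction_width[OF assms(1-4,7-13,15-18)]
  have width_le: "real (width \<beta> n) powr c \<le> 4 * real n powr (c / (2 * \<beta> + 1))" if "0 < n" "- 2 \<le> c" "c \<le> 2" for n c
    using width_powr_le[OF \<beta> that(1)] that by simp
  have ln_ge_1: "\<forall>\<^sub>F n in sequentially. 1 \<le> ln (real n)"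
    by real_asymp
  have "\<exists>M>0. (\<lambda>n. expected_posterior_mass \<rho> PX f0 (relu_prior (width \<alpha> n) (\<sigma>_oracle n) h g) n
      (M * (real n powr (- \<beta> / (1 + 2 * \<beta>)) * ((real (N\<alpha> n) * real (N\<beta> n)) powr (p / (2 + p))
        * ln (real n) powr (p / (q * (2 + p)))))\<^sup>2)) \<longlonglongrightarrow> 0"
  proof (rule contraction)
    let ?\<kappa> = "\<lambda>n. (real (N\<alpha> n) * real (N\<beta> n)) powr (p / (2 + p)) * ln (real n) powr (p / (q * (2 + p)))"
    have N1: "1 \<le> real (width s n)" for s n using width_pos[of s n] by simp
    show "\<forall>\<^sub>F n in sequentially. 0 < \<sigma>_oracle n \<and> 1 \<le> ?\<kappa> n"
      using ln_ge_1
    proof eventually_elim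
      case (elim n)
      have "1 * 1 \<le> real (N\<alpha> n) * real (N\<beta> n)" unfolding N\<alpha>_def N\<beta>_def by (intro mult_mono N1) auto
      then have "1 * 1 \<le> ?\<kappa> n" using elim p q by (intro mult_mono ge_one_powr_ge_zero) auto
      moreover have "0 < \<sigma>_oracle n"
        using elim by (simp add: \<sigma>_oracle_def N\<alpha>_def N\<beta>_def width_pos)
      ultimately show ?case by simp
    qed
    show "\<forall>\<^sub>F n in sequentially. real (width \<alpha> n) * \<sigma>_oracle n * ln (real n) powr (1 / q)
        \<le> 32 * (real n powr (- \<beta> / (1 + 2 * \<beta>)) * ?\<kappa> n)"
      using ln_ge_1 eventually_gt_at_top[of 0]
    proof eventually_elim
      case (elim n)
      then have l: "0 < ln (real n)" by linarith
      have "real (width \<alpha> n) * \<sigma>_oracle n * ln (real n) powr (1 / q) = real (width \<beta> n) powr - \<beta> * ?\<kappa> n"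
        unfolding \<sigma>_oracle_def N\<alpha>_def N\<beta>_def
        by (rule tuned_scaling_identities(1)[OF _ _ l p(1) q]) (simp_all add: width_pos)
      also have "\<dots> \<le> (32 * real n powr (- \<beta> / (1 + 2 * \<beta>))) * ?\<kappa> n"
      proof (rule mult_right_mono)
        have "real (width \<beta> n) powr - \<beta> \<le> 4 * real n powr (- \<beta> / (2 * \<beta> + 1))"
          using elim \<beta> by (intro width_le) auto
        then show "real (width \<beta> n) powr - \<beta> \<le> 32 * real n powr (- \<beta> / (1 + 2 * \<beta>))"
          by (rule order_trans) (simp add: add.commute)
      qed auto
      finally show ?case by simp
    qed
    show "\<forall>\<^sub>F n in sequentially. (real (width \<beta> n) powr (1 - \<beta>) / \<sigma>_oracle n) powr p \<le> 16 * (?\<kappa> n)\<^sup>2"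
      using ln_ge_1
    proof eventually_elim
      case (elim n)
      then have l: "0 < ln (real n)" by linarith
      have "(real (width \<beta> n) powr (1 - \<beta>) / \<sigma>_oracle n) powr p = (?\<kappa> n)\<^sup>2"
        unfolding \<sigma>_oracle_def N\<alpha>_def N\<beta>_def
        by (rule tuned_scaling_identities(2)[OF _ _ l p(1) q]) (simp_all add: width_pos)
      then show ?case by simp
    qed
  qed
  then have tuned: "\<exists>M>0. (\<lambda>n. expected_posterior_mass \<rho> PX f0 (relu_prior (N\<alpha> n) (\<sigma>_oracle n) h g) n
      (M * (\<epsilon>_oracle n)\<^sup>2)) \<longlonglongrightarrow> 0"
    by (simp add: \<epsilon>_oracle_def \<epsilon>_star_def N\<alpha>_def mult.assoc)
  \<comment> \<open>Up to constants, \<open>n powr (2 * \<theta>)\<close> bounds the slope change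
    divided by the scaling, so the weight condition calls for \<kappa> of order
    \<open>n powr (p * \<theta>)\<close>.\<close>
  define \<theta> where "\<theta> = (1 - \<beta>) / (2 + 4 * \<beta>) + 1 / 5 + 1 / (2 + 4 * \<alpha>)"
  \<comment> \<open>As \<alpha> \<le> \<beta>, the remaining two terms are at least
    \<open>(2 - \<beta>) / (2 + 4 * \<beta>)\<close>, which is nonnegative. The positive lower bound
    leaves room for the logarithm.\<close>
  have \<theta>: "1 / 5 \<le> \<theta>"
  proof -
    have "1 / (2 + 4 * \<beta>) \<le> 1 / (2 + 4 * \<alpha>)" using \<alpha> by (intro divide_left_mono) auto
    moreover have "0 \<le> (1 - \<beta>) / (2 + 4 * \<beta>) + 1 / (2 + 4 * \<beta>)"
      using \<beta> by (simp flip: add_divide_distrib)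
    ultimately show ?thesis unfolding \<theta>_def by linarith
  qed
  have "\<exists>M>0. (\<lambda>n. expected_posterior_mass \<rho> PX f0 (relu_prior (width \<alpha> n) (\<sigma>_nonoracle n) h g) n
      (M * (real n powr (- \<beta> / (1 + 2 * \<beta>)) * real n powr (p * \<theta>))\<^sup>2)) \<longlonglongrightarrow> 0"
  proof (rule contraction)
    show "\<forall>\<^sub>F n in sequentially. 0 < \<sigma>_nonoracle n \<and> 1 \<le> real n powr (p * \<theta>)"
      using eventually_gt_at_top[of 0]
    proof eventually_elim
      case (elim n)
      then have "1 \<le> real n powr (p * \<theta>)" using p \<theta> by (intro ge_one_powr_ge_zero) auto
      then show ?case using elim by (simp add: \<sigma>_nonoracle_def \<epsilon>_plus_def N\<alpha>_def width_pos)
    qed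
    have "\<forall>\<^sub>F n in sequentially. ln (real n) powr (1 / q) \<le> real n powr (p / 5)"
      using p q by real_asymp
    then show "\<forall>\<^sub>F n in sequentially. real (width \<alpha> n) * \<sigma>_nonoracle n * ln (real n) powr (1 / q)
        \<le> 32 * (real n powr (- \<beta> / (1 + 2 * \<beta>)) * real n powr (p * \<theta>))"
      using eventually_gt_at_top[of 0]
    proof eventually_elim
      case (elim n)
      have "real (width \<alpha> n) * \<sigma>_nonoracle n * ln (real n) powr (1 / q)
          = real n powr (- 2 / 5) * ln (real n) powr (1 / q)"
        using width_pos[of \<alpha> n] by (simp add: \<sigma>_nonoracle_def \<epsilon>_plus_def N\<alpha>_def)
      also have "\<dots> \<le> real n powr (- \<beta> / (1 + 2 * \<beta>)) * real n powr (p * \<theta>)"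
      proof (rule mult_mono)
        \<comment> \<open>Equivalent to \<beta> \<le> 2 for n > 1: smoothness 2 has the fastest rate
          in the range.\<close>
        show "real n powr (- 2 / 5) \<le> real n powr (- \<beta> / (1 + 2 * \<beta>))"
          using elim \<beta> by (intro powr_mono) (auto simp: field_simps)
        have "p * (1 / 5) \<le> p * \<theta>" using p \<theta> by (intro mult_left_mono) auto
        then have "real n powr (p / 5) \<le> real n powr (p * \<theta>)"
          using elim by (intro powr_mono) auto
        with elim(1) show "ln (real n) powr (1 / q) \<le> real n powr (p * \<theta>)" by linarith
      qed auto
      also have "\<dots> \<le> 32 * (real n powr (- \<beta> / (1 + 2 * \<beta>)) * real n powr (p * \<theta>))" by simp
      finally show ?case .
    qed
    show "\<forall>\<^sub>F n in sequentially. (real (width \<beta> n) powr (1 - \<beta>) / \<sigma>_nonoracle n) powr p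
        \<le> 16 * (real n powr (p * \<theta>))\<^sup>2"
      using eventually_gt_at_top[of 0]
    proof eventually_elim
      case (elim n)
      have "real (width \<beta> n) powr (1 - \<beta>) / \<sigma>_nonoracle n
          = real (width \<beta> n) powr (1 - \<beta>) * (real n powr (2 / 5) * real (width \<alpha> n))"
        by (simp add: \<sigma>_nonoracle_def \<epsilon>_plus_def N\<alpha>_def powr_minus_divide)
      also have "\<dots> \<le> (4 * real n powr ((1 - \<beta>) / (2 * \<beta> + 1))) * (real n powr (2 / 5) * (2 * real n powr (1 / (2 * \<alpha> + 1))))"
        using elim \<beta> \<alpha> by (intro mult_mono width_le width_bounds) auto
      also have "\<dots> = 8 * real n powr ((1 - \<beta>) / (2 * \<beta> + 1) + 2 / 5 + 1 / (2 * \<alpha> + 1))"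
        by (simp add: powr_add)
      also have "(1 - \<beta>) / (2 * \<beta> + 1) + 2 / 5 + 1 / (2 * \<alpha> + 1) = 2 * \<theta>"
      proof -
        have *: "(1 - \<beta>) / (2 + 4 * \<beta>) = (1 - \<beta>) / (2 * \<beta> + 1) / 2" "1 / (2 + 4 * \<alpha>) = 1 / (2 * \<alpha> + 1) / 2"
          using \<alpha> \<beta> by (simp_all add: field_simps)
        have "x + 2 / 5 + y = 2 * (x / 2 + 1 / 5 + y / 2)" for x y :: real by simp
        then show ?thesis unfolding \<theta>_def * .
      qed
      finally have "(real (width \<beta> n) powr (1 - \<beta>) / \<sigma>_nonoracle n) powr p \<le> (8 * real n powr (2 * \<theta>)) powr p"
        using p by (intro powr_mono2) (auto simp: \<sigma>_nonoracle_def \<epsilon>_plus_def)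
      also have "\<dots> = 8 powr p * (real n powr (p * \<theta>))\<^sup>2"
        by (simp add: powr_mult powr_powr power2_eq_square mult_ac flip: powr_add)
      \<comment> \<open>The 8 collects the factors 4 and 2 of the two widths, and p \<le> 1 keeps
        its power at most 8.\<close>
      also have "8 powr p \<le> 16" using powr_mono[of p 1 "8 :: real"] p by simp
      finally show ?case by (simp add: mult_right_mono)
    qed
  qed
  then have "\<exists>M>0. (\<lambda>n. expected_posterior_mass \<rho> PX f0 (relu_prior (N\<alpha> n) (\<sigma>_nonoracle n) h g) n
      (M * (\<epsilon>_nonoracle n)\<^sup>2)) \<longlonglongrightarrow> 0"
    by (simp add: \<epsilon>_nonoracle_def \<epsilon>_star_def N\<alpha>_def \<theta>_def)
  with tuned show ?thesis by blast
qed

end
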